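(* Let $X$ be a Hausdorff space equipped with a Radon valuation $\mu$. Then there exists a measure $\mu_*$ on the locale of sublocales $\mathfrak{Sl}(X)$ of $X$ which is invariant under measure-preserving homeomorphisms of $X$, and such that the natural continuous map $\mathfrak{Sl}(X)\rightarrow X$ is measure-preserving. Here invariance means that for every homeomorphism $f:X\to X$ with $\mu(f^{-1}(K))=\mu(K)$ for all compact $K\subset X$, the induced map $\mathfrak{Sl}(f):\mathfrak{Sl}(X)\to\mathfrak{Sl}(X)$ preserves $\mu_*$, and $X$ is equipped with the measure $U\mapsto\sup\{\mu(K)\mid K\subset U\text{ compact}\}$ on its frame of open sets.
   Context: A frame is a poset with arbitrary suprema and finite infima satisfying $V\wedge\bigvee_i U_i=\bigvee_i(V\wedge U_i)$; locales are the objects of the opposite category of frames, $\mathcal{O}(L)$ is the frame of $L$, and a continuous map $f:L\to M$ is a frame homomorphism $f^*:\mathcal{O}(M)\to\mathcal{O}(L)$ (preserving arbitrary suprema and finite infima). Hausdorff spaces are identified with the locales of their frames of opens. A measure on $L$ is a monotone map $\nu:\mathcal{O}(L)\to[0,\infty]$ with $\nu(0)=0$, $\nu(U)+\nu(V)=\nu(U\vee V)+\nu(U\wedge V)$, and $\nu(\bigvee_iU_i)=\sup_i\nu(U_i)$ for directed families. A continuous map $f:(L,\nu)\to(M,\nu')$ is measure-preserving if $\nu(f^*(U))=\nu'(U)$ for all opens $U$ of $M$. A sublocale of $L$ is a subset $S\subset\mathcal{O}(L)$ that is a frame in the induced order and whose inclusion is right adjoint to a frame homomorphism $\mathcal{O}(L)\to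 S$. The poset $\mathrm{Sl}(L)$ of sublocales ordered by inclusion is a coframe; the locale of sublocales $\mathfrak{Sl}(L)$ is the locale with frame $\mathrm{Sl}(L)^{op}$. The natural map $\mathfrak{Sl}(L)\to L$ has inverse image sending an open $U$ to the closed sublocale $U^c=\{V\mid U\le V\}$. A continuous map $f:L\to M$ induces $\mathfrak{Sl}(f):\mathfrak{Sl}(L)\to\mathfrak{Sl}(M)$ whose inverse image takes preimages (pullbacks) of sublocales along $f$. For a Hausdorff space $X$, $\mathcal{K}(X)$ is the lattice of compact subsets. A Radon valuation on $X$ is a map $\mu:\mathcal{K}(X)\to[0,\infty)$ that is monotone, with $\mu(\emptyset)=0$, $\mu(C)+\mu(D)=\mu(C\cup D)+\mu(C\cap D)$, and almost Boolean: for any compact $C$, any ascending sequence of compacts $C_0\subset C_1\subset\cdots\subset C$ and any $\epsilon>0$ there are $N\in\mathbb{N}$ and a compact $D\subset C$ with $\mu(D\cap C_n)=0$ for all $n$ and $\mu(C)-\mu(D\cup C_N)<\epsilon$. *)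

theory Defs
  imports "HOL-Algebra.Complete_Lattice" "HOL-Analysis.Analysis"
begin

section \<open>Frames and locales\<close>

text \<open>A locale is represented by its frame of opens, a \<open>gorder\<close> of HOL-Algebra with an explicit
  carrier. A continuous map \<open>L \<rightarrow> M\<close> is represented by its inverse image, a frame homomorphism
  from \<open>M\<close> to \<open>L\<close>.\<close>

locale frame = complete_lattice L for L (structure) +
  assumes inf_sup_distrib:
    "\<lbrakk>v \<in> carrier L; A \<subseteq> carrier L\<rbrakk> \<Longrightarrow> v \<sqinter> (\<Squnion>A) = \<Squnion>((\<lambda>u. v \<sqinter> u) ` A)"

definition frame_hom ::
    "('a, 'c) gorder_scheme \<Rightarrow> ('b, 'd) gorder_scheme \<Rightarrow> ('a \<Rightarrow> 'b) \<Rightarrow> bool" where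
  "frame_hom L M h \<longleftrightarrow>
     frame L \<and> frame M \<and> h \<in> carrier L \<rightarrow> carrier M \<and>
     sup_pres L M h \<and>
     h \<top>\<^bsub>L\<^esub> = \<top>\<^bsub>M\<^esub> \<and>
     (\<forall>u\<in>carrier L. \<forall>v\<in>carrier L. h (u \<sqinter>\<^bsub>L\<^esub> v) = h u \<sqinter>\<^bsub>M\<^esub> h v)"

definition opens :: "'a topology \<Rightarrow> 'a set gorder" where
  "opens X = \<lparr>carrier = {U. openin X U}, eq = (=), le = (\<subseteq>)\<rparr>"

definition opens_map :: "'a topology \<Rightarrow> ('a \<Rightarrow> 'b) \<Rightarrow> 'b set \<Rightarrow> 'a set" where
  "opens_map X f U = {x \<in> topspace X. f x \<in> U}"

section \<open>Measures on locales\<close>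

definition directed_in :: "('a, 'c) gorder_scheme \<Rightarrow> 'a set \<Rightarrow> bool" where
  "directed_in L D \<longleftrightarrow>
     D \<subseteq> carrier L \<and> D \<noteq> {} \<and>
     (\<forall>u\<in>D. \<forall>v\<in>D. \<exists>w\<in>D. u \<sqsubseteq>\<^bsub>L\<^esub> w \<and> v \<sqsubseteq>\<^bsub>L\<^esub> w)"

definition locale_measure :: "('a, 'c) gorder_scheme \<Rightarrow> ('a \<Rightarrow> ennreal) \<Rightarrow> bool" where
  "locale_measure L \<nu> \<longleftrightarrow>
     frame L \<and>
     (\<forall>u\<in>carrier L. \<forall>v\<in>carrier L. u \<sqsubseteq>\<^bsub>L\<^esub> v \<longrightarrow> \<nu> u \<le> \<nu> v) \<and>
     \<nu> \<bottom>\<^bsub>L\<^esub> = 0 \<and>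
     (\<forall>u\<in>carrier L. \<forall>v\<in>carrier L. \<nu> u + \<nu> v = \<nu> (u \<squnion>\<^bsub>L\<^esub> v) + \<nu> (u \<sqinter>\<^bsub>L\<^esub> v)) \<and>
     (\<forall>D. directed_in L D \<longrightarrow> \<nu> (\<Squnion>\<^bsub>L\<^esub>D) = (SUP u\<in>D. \<nu> u))"

text \<open>\<open>measure_preserving_map L \<nu> M \<nu>' h\<close>: the continuous map \<open>(L, \<nu>) \<rightarrow> (M, \<nu>')\<close> with inverse
  image \<open>h\<close> is measure-preserving.\<close>

definition measure_preserving_map ::
    "('a, 'c) gorder_scheme \<Rightarrow> ('a \<Rightarrow> ennreal) \<Rightarrow> ('b, 'd) gorder_scheme \<Rightarrow> ('b \<Rightarrow> ennreal)
      \<Rightarrow> ('b \<Rightarrow> 'a) \<Rightarrow> bool" where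
  "measure_preserving_map L \<nu> M \<nu>' h \<longleftrightarrow>
     frame_hom M L h \<and> (\<forall>u\<in>carrier M. \<nu> (h u) = \<nu>' u)"

section \<open>The locale of sublocales\<close>

definition is_sublocale :: "('a, 'c) gorder_scheme \<Rightarrow> 'a set \<Rightarrow> bool" where
  "is_sublocale L S \<longleftrightarrow>
     S \<subseteq> carrier L \<and>
     (\<exists>h. frame_hom L (L\<lparr>carrier := S\<rparr>) h \<and>
          (\<forall>u\<in>carrier L. \<forall>s\<in>S. h u \<sqsubseteq>\<^bsub>L\<^esub> s \<longleftrightarrow> u \<sqsubseteq>\<^bsub>L\<^esub> s))"

definition Sl :: "('a, 'c) gorder_scheme \<Rightarrow> 'a set gorder" where
  "Sl L = \<lparr>carrier = {S. is_sublocale L S}, eq = (=), le = (\<subseteq>)\<rparr>"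

definition sublocale_locale :: "('a, 'c) gorder_scheme \<Rightarrow> 'a set gorder" where
  "sublocale_locale L = inv_gorder (Sl L)"

definition closed_sublocale :: "('a, 'c) gorder_scheme \<Rightarrow> 'a \<Rightarrow> 'a set" where
  "closed_sublocale L u = {v \<in> carrier L. u \<sqsubseteq>\<^bsub>L\<^esub> v}"

text \<open>The right adjoint (direct image) of a frame homomorphism \<open>h\<close> from \<open>M\<close> to \<open>L\<close>.\<close>

definition direct_image ::
    "('a, 'c) gorder_scheme \<Rightarrow> ('b, 'd) gorder_scheme \<Rightarrow> ('b \<Rightarrow> 'a) \<Rightarrow> 'a \<Rightarrow> 'b" where
  "direct_image L M h u = \<Squnion>\<^bsub>M\<^esub>{v \<in> carrier M. h v \<sqsubseteq>\<^bsub>L\<^esub> u}"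

text \<open>The pullback of a sublocale \<open>S\<close> of \<open>M\<close> along the map \<open>L \<rightarrow> M\<close> with inverse image \<open>h\<close> is the
  largest sublocale \<open>T\<close> of \<open>L\<close> whose map \<open>T \<rightarrow> L \<rightarrow> M\<close> factors through \<open>S\<close>. The map factors
  through \<open>S\<close> exactly when the direct image takes \<open>T\<close> into \<open>S\<close>.\<close>

definition sublocale_preimage ::
    "('a, 'c) gorder_scheme \<Rightarrow> ('b, 'd) gorder_scheme \<Rightarrow> ('b \<Rightarrow> 'a) \<Rightarrow> 'b set \<Rightarrow> 'a set" where
  "sublocale_preimage L M h S =
     \<Squnion>\<^bsub>Sl L\<^esub>{T. is_sublocale L T \<and> direct_image L M h ` T \<subseteq> S}"

section \<open>Radon valuations\<close>

text \<open>Only the values of \<open>\<mu>\<close> on compact subsets of \<open>X\<close> are relevant.\<close>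

definition radon_valuation :: "'a topology \<Rightarrow> ('a set \<Rightarrow> real) \<Rightarrow> bool" where
  "radon_valuation X \<mu> \<longleftrightarrow>
     (\<forall>C. compactin X C \<longrightarrow> 0 \<le> \<mu> C) \<and>
     (\<forall>C D. compactin X C \<longrightarrow> compactin X D \<longrightarrow> C \<subseteq> D \<longrightarrow> \<mu> C \<le> \<mu> D) \<and>
     \<mu> {} = 0 \<and>
     (\<forall>C D. compactin X C \<longrightarrow> compactin X D \<longrightarrow> \<mu> C + \<mu> D = \<mu> (C \<union> D) + \<mu> (C \<inter> D)) \<and>
     (\<forall>C K \<epsilon>. compactin X C \<longrightarrow> (\<forall>n::nat. compactin X (K n) \<and> K n \<subseteq> K (Suc n) \<and> K n \<subseteq> C) \<longrightarrow>
        0 < \<epsilon> \<longrightarrow>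
        (\<exists>N D. compactin X D \<and> D \<subseteq> C \<and> (\<forall>n. \<mu> (D \<inter> K n) = 0) \<and> \<mu> C - \<mu> (D \<union> K N) < \<epsilon>))"

definition radon_open_measure :: "'a topology \<Rightarrow> ('a set \<Rightarrow> real) \<Rightarrow> 'a set \<Rightarrow> ennreal" where
  "radon_open_measure X \<mu> U = (SUP K\<in>{K. compactin X K \<and> K \<subseteq> U}. ennreal (\<mu> K))"

end

theory Submission
  imports Defs
begin

text \<open>
  For a compact set \<open>C\<close>, let \<open>\<nu> C U\<close> be the supremum of \<open>\<mu> K\<close> over compact \<open>K \<subseteq> C \<inter> U\<close>. This is a
  finite, modular function of the open set \<open>U\<close> that is continuous along directed unions. It
  extends to sublocales as an outer measure: \<open>outer C S\<close> is the infimum of \<open>\<nu> C U\<close> over the open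
  neighbourhoods \<open>U\<close> of \<open>S\<close>. A sublocale \<open>S\<close>, regarded as an element of the frame of the locale of
  sublocales, gets as its measure the mass outside \<open>S\<close>, that is, the supremum over all compact
  \<open>C\<close> of \<open>\<mu> C - outer C S\<close>. On the closed sublocale complementary to an open set \<open>U\<close> this gives
  the supremum of \<open>\<nu> C U\<close>, which is the measure of \<open>U\<close>. Invariance holds because the definition
  mentions only \<open>\<mu>\<close> and the topology.

  What has to be proved is that the outer measure is modular and continuous along filtered
  intersections of sublocales. Both follow from \<open>nbhds_Inter_approx\<close>: if a filter \<open>H\<close>
  of opens contains all neighbourhoods of each sublocale of a family, and \<open>U\<close> is a neighbourhood of
  the intersection of the family, then for every \<open>e > 0\<close> some member of \<open>H\<close> has
  measure less than \<open>\<nu> C U + e\<close>. For sets of points this would fail, since an intersection of sets can be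
  empty while all their neighbourhoods are large; sublocales have enough room because they
  need not have points. Concretely, call \<open>V\<close> negligible over \<open>U\<close> if the measure of
  \<open>(V \<inter> W) - U\<close> becomes arbitrarily small for \<open>W\<close> in \<open>H\<close>. The opens \<open>U\<close> that contain every open
  set negligible over them form a sublocale, the \<open>support\<close> of \<open>\<nu> C\<close> along \<open>H\<close>. Inner regularity by
  compact sets puts the support inside every member of the family (\<open>support_subset\<close>), hence
  inside the intersection, so \<open>U\<close> is a neighbourhood of the support; and for such \<open>U\<close> the whole
  space is negligible over \<open>U\<close> (\<open>nbhds_support_nu\<close>), which is the claim.

  Additivity of the supremum over \<open>C\<close> needs \<open>\<mu> C - outer C S\<close> to increase with \<open>C\<close>
  (\<open>mu_minus_outer_mono\<close>); this comes from modularity of \<open>\<mu>\<close>.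

  On the lattice side, sublocales are characterized as the sets of opens closed under infima and
  Heyting implications (\<open>is_sublocale_iff\<close>). In these terms intersections and joins of
  sublocales are explicit, the coframe law is a short computation, and the
  preimage along a homeomorphism is the image under the induced bijection of opens.
\<close>

section \<open>Frames and frame homomorphisms\<close>

lemma (in partial_order) sup_eqI:
  assumes "A \<subseteq> carrier L" "x \<in> carrier L" "\<And>a. a \<in> A \<Longrightarrow> a \<sqsubseteq> x"
    and "\<And>y. y \<in> carrier L \<Longrightarrow> (\<And>a. a \<in> A \<Longrightarrow> a \<sqsubseteq> y) \<Longrightarrow> x \<sqsubseteq> y"
  shows "\<Squnion>A = x"
proof -
  have "least L x (Upper L A)"
    unfolding least_def Upper_def using assms(1-3) by (auto intro!: assms(4))
  then show ?thesis
    unfolding sup_def by (metis (mono_tags, lifting) least_unique someI)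
qed

lemma (in partial_order) meet_eqI:
  assumes "x \<in> carrier L" "y \<in> carrier L" "z \<in> carrier L" "z \<sqsubseteq> x" "z \<sqsubseteq> y"
    and "\<And>w. w \<in> carrier L \<Longrightarrow> w \<sqsubseteq> x \<Longrightarrow> w \<sqsubseteq> y \<Longrightarrow> w \<sqsubseteq> z"
  shows "x \<sqinter> y = z"
proof -
  have "greatest L z (Lower L {x, y})"
    using assms by (auto simp: greatest_def Lower_def)
  then show ?thesis
    unfolding meet_def inf_def by (metis (mono_tags, lifting) greatest_unique someI)
qed

lemma (in partial_order) top_eqI:
  assumes "t \<in> carrier L" "\<And>x. x \<in> carrier L \<Longrightarrow> x \<sqsubseteq> t"
  shows "\<top> = t"
proof -
  have "greatest L t (carrier L)"
    using assms by (auto simp: greatest_def)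
  then show ?thesis
    unfolding top_def by (metis (mono_tags, lifting) greatest_unique someI)
qed

lemma (in partial_order) bottom_eqI:
  assumes "t \<in> carrier L" "\<And>x. x \<in> carrier L \<Longrightarrow> t \<sqsubseteq> x"
  shows "\<bottom> = t"
proof -
  have "least L t (carrier L)"
    using assms by (auto simp: least_def)
  then show ?thesis
    unfolding bottom_def by (metis (mono_tags, lifting) least_unique someI)
qed

text \<open>Suprema suffice for completeness, since an infimum is the supremum of the lower bounds.\<close>

lemma (in partial_order) frame_criterion:
  assumes sg: "\<And>A. A \<subseteq> carrier L \<Longrightarrow> sg A \<in> carrier L"
    "\<And>A a. A \<subseteq> carrier L \<Longrightarrow> a \<in> A \<Longrightarrow> a \<sqsubseteq> sg A"
    "\<And>A y. A \<subseteq> carrier L \<Longrightarrow> y \<in> carrier L \<Longrightarrow> (\<And>a. a \<in> A \<Longrightarrow> a \<sqsubseteq> y) \<Longrightarrow> sg A \<sqsubseteq> y"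
    and mt: "\<And>x y. x \<in> carrier L \<Longrightarrow> y \<in> carrier L \<Longrightarrow>
      mt x y \<in> carrier L \<and> mt x y \<sqsubseteq> x \<and> mt x y \<sqsubseteq> y"
    "\<And>x y w. x \<in> carrier L \<Longrightarrow> y \<in> carrier L \<Longrightarrow> w \<in> carrier L \<Longrightarrow>
      w \<sqsubseteq> x \<Longrightarrow> w \<sqsubseteq> y \<Longrightarrow> w \<sqsubseteq> mt x y"
    and dist: "\<And>v A. v \<in> carrier L \<Longrightarrow> A \<subseteq> carrier L \<Longrightarrow> mt v (sg A) \<sqsubseteq> sg (mt v ` A)"
  shows "frame L"
proof -
  have sup: "\<Squnion>A = sg A" if "A \<subseteq> carrier L" for A
    using that by (intro sup_eqI) (auto intro: sg)
  have meet: "x \<sqinter> y = mt x y" if "x \<in> carrier L" "y \<in> carrier L" for x y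
    using that mt by (intro meet_eqI) auto
  have "complete_lattice L"
  proof (rule complete_latticeI)
    fix A assume A: "A \<subseteq> carrier L"
    show "\<exists>s. least L s (Upper L A)"
      unfolding least_def Upper_def using A
      by (intro exI[of _ "sg A"]) (auto intro: sg(1,2) intro!: sg(3))
    have "greatest L (sg (Lower L A)) (Lower L A)"
      unfolding greatest_def
    proof (intro conjI ballI)
      show "sg (Lower L A) \<in> Lower L A"
        using A by (auto simp: Lower_def intro!: sg(1,3))
    qed (auto intro!: sg(2))
    then show "\<exists>i. greatest L i (Lower L A)" ..
  qed
  moreover have "v \<sqinter> \<Squnion>A = \<Squnion>((\<lambda>u. v \<sqinter> u) ` A)" if v: "v \<in> carrier L" and A: "A \<subseteq> carrier L" for v A
  proof -
    have im: "mt v ` A \<subseteq> carrier L"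
      using mt v A by auto
    have eq: "(\<lambda>u. v \<sqinter> u) ` A = mt v ` A"
      using meet v A by (intro image_cong) auto
    have "mt v a \<sqsubseteq> mt v (sg A)" if "a \<in> A" for a
    proof (rule mt(2))
      show "mt v a \<sqsubseteq> sg A"
        by (meson A le_trans mt(1) sg(1,2) subsetD that v)
    qed (use that A v mt sg in auto)
    then have "sg (mt v ` A) \<sqsubseteq> mt v (sg A)"
      using im mt v A sg by (intro sg(3)) auto
    then have "mt v (sg A) = sg (mt v ` A)"
      using dist[OF v A] im mt v A sg by (intro le_antisym) auto
    then show ?thesis
      using eq A im v meet sup sg(1) by simp
  qed
  ultimately show ?thesis
    by (simp add: frame_def frame_axioms_def)
qed

lemma frame_complete_lattice: "frame L \<Longrightarrow> complete_lattice L"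
  by (simp add: frame_def)

lemma frame_homI:
  assumes "frame L" "frame M" "h \<in> carrier L \<rightarrow> carrier M"
    and "\<And>A. A \<subseteq> carrier L \<Longrightarrow> h (\<Squnion>\<^bsub>L\<^esub>A) = \<Squnion>\<^bsub>M\<^esub>(h ` A)"
    and "h \<top>\<^bsub>L\<^esub> = \<top>\<^bsub>M\<^esub>"
    and "\<And>u v. u \<in> carrier L \<Longrightarrow> v \<in> carrier L \<Longrightarrow> h (u \<sqinter>\<^bsub>L\<^esub> v) = h u \<sqinter>\<^bsub>M\<^esub> h v"
  shows "frame_hom L M h"
  using assms frame_complete_lattice[of L] frame_complete_lattice[of M]
  unfolding frame_hom_def sup_pres_def by simp

text \<open>A map with adjoints on both sides preserves suprema because it is a left adjoint, and finite
  meets because it is a right adjoint. This is used for order isomorphisms, where both adjoints are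
  the inverse.\<close>

lemma frame_hom_two_adjoints:
  assumes L: "frame L" and M: "frame M"
    and h: "h \<in> carrier L \<rightarrow> carrier M" and k: "k \<in> carrier M \<rightarrow> carrier L"
    and adj: "\<And>x y. x \<in> carrier L \<Longrightarrow> y \<in> carrier M \<Longrightarrow> h x \<sqsubseteq>\<^bsub>M\<^esub> y \<longleftrightarrow> x \<sqsubseteq>\<^bsub>L\<^esub> k y"
    and adj': "\<And>x y. x \<in> carrier L \<Longrightarrow> y \<in> carrier M \<Longrightarrow> y \<sqsubseteq>\<^bsub>M\<^esub> h x \<longleftrightarrow> k y \<sqsubseteq>\<^bsub>L\<^esub> x"
  shows "frame_hom L M h"
proof -
  interpret L: complete_lattice L using L by (rule frame_complete_lattice)
  interpret M: complete_lattice M using M by (rule frame_complete_lattice)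
  have hc: "h x \<in> carrier M" if "x \<in> carrier L" for x using h that by auto
  have kc: "k x \<in> carrier L" if "x \<in> carrier M" for x using k that by auto
  have mono: "h x \<sqsubseteq>\<^bsub>M\<^esub> h y" if "x \<in> carrier L" "y \<in> carrier L" "x \<sqsubseteq>\<^bsub>L\<^esub> y" for x y
  proof -
    have "k (h x) \<sqsubseteq>\<^bsub>L\<^esub> x"
      using adj'[OF that(1) hc[OF that(1)]] hc[OF that(1)] by simp
    then have "k (h x) \<sqsubseteq>\<^bsub>L\<^esub> y"
      using that hc kc L.le_trans by blast
    then show ?thesis
      using adj' hc that by simp
  qed
  show ?thesis
  proof (rule frame_homI)
    show "h (\<Squnion>\<^bsub>L\<^esub>A) = \<Squnion>\<^bsub>M\<^esub>(h ` A)" if A: "A \<subseteq> carrier L" for A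
    proof (rule M.sup_eqI[symmetric])
      show "a \<sqsubseteq>\<^bsub>M\<^esub> h (\<Squnion>\<^bsub>L\<^esub>A)" if "a \<in> h ` A" for a
        using that A by (auto intro!: mono L.sup_upper)
      show "h (\<Squnion>\<^bsub>L\<^esub>A) \<sqsubseteq>\<^bsub>M\<^esub> y" if y: "y \<in> carrier M" "\<And>a. a \<in> h ` A \<Longrightarrow> a \<sqsubseteq>\<^bsub>M\<^esub> y" for y
      proof -
        have "x \<sqsubseteq>\<^bsub>L\<^esub> k y" if "x \<in> A" for x
          using adj[of x y] y(1) y(2)[of "h x"] that A by auto
        then have "\<Squnion>\<^bsub>L\<^esub>A \<sqsubseteq>\<^bsub>L\<^esub> k y"
          using A kc[OF y(1)] by (intro L.sup_least) auto
        then show ?thesis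
          using adj[OF L.sup_closed[OF A] y(1)] by simp
      qed
    next
      show "h ` A \<subseteq> carrier M" "h (\<Squnion>\<^bsub>L\<^esub>A) \<in> carrier M"
        using A hc L.sup_closed[OF A] by blast+
    qed
    show "h \<top>\<^bsub>L\<^esub> = \<top>\<^bsub>M\<^esub>"
    proof (rule M.top_eqI[symmetric])
      show "y \<sqsubseteq>\<^bsub>M\<^esub> h \<top>\<^bsub>L\<^esub>" if "y \<in> carrier M" for y
        using adj'[OF L.top_closed that] L.top_higher[OF kc[OF that]] by simp
    qed (rule hc[OF L.top_closed])
    show "h (u \<sqinter>\<^bsub>L\<^esub> v) = h u \<sqinter>\<^bsub>M\<^esub> h v" if u: "u \<in> carrier L" "v \<in> carrier L" for u v
    proof (rule M.meet_eqI[symmetric])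
      have uv: "u \<sqinter>\<^bsub>L\<^esub> v \<in> carrier L"
        using u by (rule L.meet_closed)
      show "h (u \<sqinter>\<^bsub>L\<^esub> v) \<sqsubseteq>\<^bsub>M\<^esub> h u" "h (u \<sqinter>\<^bsub>L\<^esub> v) \<sqsubseteq>\<^bsub>M\<^esub> h v"
        using mono[OF uv u(1) L.meet_left[OF u]] mono[OF uv u(2) L.meet_right[OF u]] .
      show "w \<sqsubseteq>\<^bsub>M\<^esub> h (u \<sqinter>\<^bsub>L\<^esub> v)" if w: "w \<in> carrier M" "w \<sqsubseteq>\<^bsub>M\<^esub> h u" "w \<sqsubseteq>\<^bsub>M\<^esub> h v" for w
        using adj'[OF u(1) w(1)] adj'[OF u(2) w(1)] w adj'[OF uv w(1)]
          L.meet_le[OF _ _ u kc[OF w(1)]] by simp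
      show "h (u \<sqinter>\<^bsub>L\<^esub> v) \<in> carrier M"
        using uv by (rule hc)
    qed (rule hc[OF u(1)], rule hc[OF u(2)])
  qed (rule L, rule M, rule h)
qed

section \<open>Sublocales of a topological space as sets of opens\<close>

text \<open>The infimum of a family in the frame of opens; for the empty family it is \<open>topspace X\<close>, since
  the interior is taken in \<open>X\<close>.\<close>

definition open_Inter :: "'a topology \<Rightarrow> 'a set set \<Rightarrow> 'a set" where
  "open_Inter X A = X interior_of \<Inter>A"

text \<open>The Heyting implication of the frame of opens.\<close>

definition open_imp :: "'a topology \<Rightarrow> 'a set \<Rightarrow> 'a set \<Rightarrow> 'a set" where
  "open_imp X U V = \<Union>{W. openin X W \<and> W \<inter> U \<subseteq> V}"

lemma openin_open_Inter [simp]: "openin X (open_Inter X A)"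
  by (simp add: open_Inter_def)

lemma openin_open_imp [simp]: "openin X (open_imp X U V)"
  by (auto simp: open_imp_def)

lemma subset_open_Inter_iff:
  "openin X U \<Longrightarrow> U \<subseteq> open_Inter X A \<longleftrightarrow> (\<forall>V\<in>A. U \<subseteq> V)"
  unfolding open_Inter_def by (auto simp: interior_of_maximal_eq dest: openin_subset)

lemma open_Inter_lower: "V \<in> A \<Longrightarrow> open_Inter X A \<subseteq> V"
  using subset_open_Inter_iff[of X "open_Inter X A" A] by simp

lemma subset_open_imp_iff:
  "openin X W \<Longrightarrow> W \<subseteq> open_imp X U V \<longleftrightarrow> W \<inter> U \<subseteq> V"
  unfolding open_imp_def by blast

lemma open_imp_Int: "open_imp X U V \<inter> U \<subseteq> V"
  by (auto simp: open_imp_def)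

lemma open_Inter_pair:
  assumes "openin X U" "openin X V"
  shows "open_Inter X {U, V} = U \<inter> V"
  using subset_open_Inter_iff[of X "U \<inter> V" "{U,V}"] open_Inter_lower[of _ "{U, V}" X] assms
  by (intro equalityI) auto

text \<open>The elementary description of sublocales: sets of opens closed under infima and under
  implications with an arbitrary antecedent. All later constructions of sublocales verify these
  closure conditions instead of exhibiting a left adjoint; \<open>is_sublocale_iff\<close> below shows
  that this is the same.\<close>

definition sublocale_set :: "'a topology \<Rightarrow> 'a set set \<Rightarrow> bool" where
  "sublocale_set X S \<longleftrightarrow>
     (\<forall>U\<in>S. openin X U) \<and>
     (\<forall>A\<subseteq>S. open_Inter X A \<in> S) \<and>
     (\<forall>U V. openin X U \<longrightarrow> V \<in> S \<longrightarrow> open_imp X U V \<in> S)"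

lemma sublocale_set_openin: "sublocale_set X S \<Longrightarrow> U \<in> S \<Longrightarrow> openin X U"
  by (simp add: sublocale_set_def)

lemma sublocale_set_open_Inter: "sublocale_set X S \<Longrightarrow> A \<subseteq> S \<Longrightarrow> open_Inter X A \<in> S"
  by (simp add: sublocale_set_def)

lemma sublocale_set_open_imp:
  "sublocale_set X S \<Longrightarrow> openin X U \<Longrightarrow> V \<in> S \<Longrightarrow> open_imp X U V \<in> S"
  by (simp add: sublocale_set_def)

lemma sublocale_set_topspace:
  assumes "sublocale_set X S"
  shows "topspace X \<in> S"
proof -
  have "open_Inter X {} = topspace X"
    using subset_open_Inter_iff[of X "topspace X" "{}"] by (simp add: openin_subset subset_antisym)
  then show ?thesis
    by (metis assms empty_subsetI sublocale_set_open_Inter)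
qed

lemma sublocale_set_Int:
  assumes "sublocale_set X S" "U \<in> S" "V \<in> S"
  shows "U \<inter> V \<in> S"
  using sublocale_set_open_Inter[of X S "{U, V}"] open_Inter_pair[of X U V]
    sublocale_set_openin[of X S] assms by simp

text \<open>The reflection of opens into \<open>S\<close>, left adjoint to the inclusion.\<close>

definition nucleus :: "'a topology \<Rightarrow> 'a set set \<Rightarrow> 'a set \<Rightarrow> 'a set" where
  "nucleus X S U = open_Inter X {V \<in> S. U \<subseteq> V}"

lemma openin_nucleus [simp]: "openin X (nucleus X S U)"
  by (simp add: nucleus_def)

lemma nucleus_in: "sublocale_set X S \<Longrightarrow> nucleus X S U \<in> S"
  unfolding nucleus_def by (intro sublocale_set_open_Inter) auto

lemma nucleus_upper: "openin X U \<Longrightarrow> U \<subseteq> nucleus X S U"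
  by (simp add: nucleus_def subset_open_Inter_iff)

lemma nucleus_least: "V \<in> S \<Longrightarrow> U \<subseteq> V \<Longrightarrow> nucleus X S U \<subseteq> V"
  unfolding nucleus_def by (rule open_Inter_lower) simp

lemma nucleus_le_iff: "openin X U \<Longrightarrow> V \<in> S \<Longrightarrow> nucleus X S U \<subseteq> V \<longleftrightarrow> U \<subseteq> V"
  using nucleus_upper nucleus_least by (metis subset_trans)

lemma nucleus_mono: "openin X V \<Longrightarrow> sublocale_set X S \<Longrightarrow> U \<subseteq> V \<Longrightarrow> nucleus X S U \<subseteq> nucleus X S V"
  by (meson nucleus_in nucleus_least nucleus_upper order_trans)

text \<open>Closure under \<open>open_imp\<close> is what makes the reflection preserve binary meets: by the adjunction
  each factor of \<open>U \<inter> V\<close> can be enlarged in turn.\<close>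

lemma nucleus_Int:
  assumes S: "sublocale_set X S" and U: "openin X U" and V: "openin X V"
  shows "nucleus X S (U \<inter> V) = nucleus X S U \<inter> nucleus X S V"
proof
  let ?T = "nucleus X S (U \<inter> V)"
  have T: "?T \<in> S"
    using S by (rule nucleus_in)
  have "U \<inter> V \<subseteq> ?T"
    using U V by (intro nucleus_upper) auto
  then have "nucleus X S U \<subseteq> open_imp X V ?T"
    using U V S T by (intro nucleus_least sublocale_set_open_imp) (auto simp: subset_open_imp_iff)
  then have "V \<subseteq> open_imp X (nucleus X S U) ?T"
    using V by (auto simp: subset_open_imp_iff)
  then have "nucleus X S V \<subseteq> open_imp X (nucleus X S U) ?T"
    using U V S T by (intro nucleus_least sublocale_set_open_imp) auto
  then show "nucleus X S U \<inter> nucleus X S V \<subseteq> ?T"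
    by (auto simp: subset_open_imp_iff)
next
  show "nucleus X S (U \<inter> V) \<subseteq> nucleus X S U \<inter> nucleus X S V"
    using assms by (simp add: nucleus_mono)
qed

lemma opens_sel [simp]:
  "carrier (opens X) = {U. openin X U}" "(.=\<^bsub>opens X\<^esub>) = (=)" "(\<sqsubseteq>\<^bsub>opens X\<^esub>) = (\<subseteq>)"
  by (auto simp: opens_def)

lemma partial_order_subset_opens: "partial_order (opens X\<lparr>carrier := S\<rparr>)"
  by unfold_locales (auto simp: opens_def)

text \<open>The distributive law is inherited from the frame of opens because the reflection preserves
  binary meets.\<close>

lemma
  assumes S: "sublocale_set X S"
  shows frame_sublocale_set: "frame (opens X\<lparr>carrier := S\<rparr>)"
    and sup_sublocale_set: "A \<subseteq> S \<Longrightarrow> \<Squnion>\<^bsub>opens X\<lparr>carrier := S\<rparr>\<^esub>A = nucleus X S (\<Union>A)"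
    and meet_sublocale_set: "U \<in> S \<Longrightarrow> V \<in> S \<Longrightarrow> U \<sqinter>\<^bsub>opens X\<lparr>carrier := S\<rparr>\<^esub> V = U \<inter> V"
    and top_sublocale_set: "\<top>\<^bsub>opens X\<lparr>carrier := S\<rparr>\<^esub> = topspace X"
proof -
  interpret partial_order "opens X\<lparr>carrier := S\<rparr>"
    by (rule partial_order_subset_opens)
  note o = sublocale_set_openin[OF S]
  have oU: "openin X (\<Union>A)" if "A \<subseteq> S" for A
    using that o by auto
  show "frame (opens X\<lparr>carrier := S\<rparr>)"
  proof (rule frame_criterion[where sg = "\<lambda>A. nucleus X S (\<Union>A)" and mt = "(\<inter>)"])
    show "v \<inter> nucleus X S (\<Union>A) \<sqsubseteq>\<^bsub>opens X\<lparr>carrier := S\<rparr>\<^esub> nucleus X S (\<Union>((\<inter>) v ` A))"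
      if "v \<in> carrier (opens X\<lparr>carrier := S\<rparr>)" "A \<subseteq> carrier (opens X\<lparr>carrier := S\<rparr>)" for v A
    proof -
      have v: "v \<in> S" "openin X v" and A: "A \<subseteq> S"
        using that o by auto
      have eq: "\<Union>((\<inter>) v ` A) = v \<inter> \<Union>A"
        by auto
      have "v \<subseteq> nucleus X S v"
        using v by (simp add: nucleus_upper)
      then show ?thesis
        unfolding eq using nucleus_Int[OF S v(2) oU[OF A]] by auto
    qed
  next
    fix A a y
    assume A: "A \<subseteq> carrier (opens X\<lparr>carrier := S\<rparr>)"
    show "nucleus X S (\<Union>A) \<in> carrier (opens X\<lparr>carrier := S\<rparr>)"
      by (simp add: nucleus_in S)
    show "a \<sqsubseteq>\<^bsub>opens X\<lparr>carrier := S\<rparr>\<^esub> nucleus X S (\<Union>A)" if "a \<in> A"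
      using that A nucleus_upper[OF oU, of A S] by auto
    show "nucleus X S (\<Union>A) \<sqsubseteq>\<^bsub>opens X\<lparr>carrier := S\<rparr>\<^esub> y"
      if "y \<in> carrier (opens X\<lparr>carrier := S\<rparr>)" "\<And>a. a \<in> A \<Longrightarrow> a \<sqsubseteq>\<^bsub>opens X\<lparr>carrier := S\<rparr>\<^esub> y"
      using that nucleus_least[of y S "\<Union>A" X] by auto
  qed (auto simp: sublocale_set_Int[OF S])
  show "\<Squnion>\<^bsub>opens X\<lparr>carrier := S\<rparr>\<^esub>A = nucleus X S (\<Union>A)" if A: "A \<subseteq> S"
  proof (rule sup_eqI)
    show "a \<sqsubseteq>\<^bsub>opens X\<lparr>carrier := S\<rparr>\<^esub> nucleus X S (\<Union>A)" if "a \<in> A" for a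
      using that nucleus_upper[OF oU[OF A], of S] by auto
    show "nucleus X S (\<Union>A) \<sqsubseteq>\<^bsub>opens X\<lparr>carrier := S\<rparr>\<^esub> y"
      if "y \<in> carrier (opens X\<lparr>carrier := S\<rparr>)" "\<And>a. a \<in> A \<Longrightarrow> a \<sqsubseteq>\<^bsub>opens X\<lparr>carrier := S\<rparr>\<^esub> y" for y
      using that nucleus_least[of y S "\<Union>A" X] by auto
  qed (use A nucleus_in[OF S] in auto)
  show "U \<sqinter>\<^bsub>opens X\<lparr>carrier := S\<rparr>\<^esub> V = U \<inter> V" if "U \<in> S" "V \<in> S"
    using that sublocale_set_Int[OF S] by (intro meet_eqI) auto
  show "\<top>\<^bsub>opens X\<lparr>carrier := S\<rparr>\<^esub> = topspace X"
    using sublocale_set_topspace[OF S] by (intro top_eqI) (auto dest: o openin_subset)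
qed

lemma sublocale_set_opens: "sublocale_set X {U. openin X U}"
  by (simp add: sublocale_set_def)

lemma nucleus_opens: "openin X U \<Longrightarrow> nucleus X {U. openin X U} U = U"
  by (intro equalityI nucleus_least nucleus_upper) auto

lemma opens_carrier_update: "opens X\<lparr>carrier := {U. openin X U}\<rparr> = opens X"
  by (simp add: opens_def)

lemma partial_order_opens: "partial_order (opens X)"
  using partial_order_subset_opens[where X = X and S = "{U. openin X U}"] by (simp add: opens_carrier_update)

lemma frame_opens: "frame (opens X)"
  using frame_sublocale_set[OF sublocale_set_opens[of X]] by (simp add: opens_carrier_update)

lemma sup_opens: "A \<subseteq> {U. openin X U} \<Longrightarrow> \<Squnion>\<^bsub>opens X\<^esub>A = \<Union>A"
  using sup_sublocale_set[OF sublocale_set_opens[of X], of A] nucleus_opens[where X = X and U = "\<Union>A"]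
  by (auto simp: opens_carrier_update)

lemma meet_opens: "openin X U \<Longrightarrow> openin X V \<Longrightarrow> U \<sqinter>\<^bsub>opens X\<^esub> V = U \<inter> V"
  using meet_sublocale_set[OF sublocale_set_opens[of X], of U V]
  by (auto simp: opens_carrier_update)

lemma top_opens: "\<top>\<^bsub>opens X\<^esub> = topspace X"
  using top_sublocale_set[OF sublocale_set_opens[of X]] by (auto simp: opens_carrier_update)

text \<open>A sublocale is closed under meets because its inclusion is a right adjoint, and under
  \<open>open_imp\<close> because the reflection preserves binary meets; conversely \<open>nucleus\<close> is the
  reflection.\<close>

lemma is_sublocale_iff: "is_sublocale (opens X) S \<longleftrightarrow> sublocale_set X S"
proof
  assume "is_sublocale (opens X) S"
  then obtain h where sub: "\<And>U. U \<in> S \<Longrightarrow> openin X U"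
    and h: "frame_hom (opens X) (opens X\<lparr>carrier := S\<rparr>) h"
    and adj: "\<And>U V. openin X U \<Longrightarrow> V \<in> S \<Longrightarrow> h U \<subseteq> V \<longleftrightarrow> U \<subseteq> V"
    unfolding is_sublocale_def opens_sel mem_Collect_eq Ball_def by (metis (no_types, lifting) mem_Collect_eq subsetD)
  have hS: "h U \<in> S" if "openin X U" for U
    using h that by (auto simp: frame_hom_def)
  have up: "U \<subseteq> h U" if "openin X U" for U
    using adj[OF that hS[OF that]] by simp
  have fixp: "U \<in> S" if "openin X U" "h U \<subseteq> U" for U
    using hS[OF that(1)] up[OF that(1)] that(2) by (simp add: subset_antisym)
  have meets: "open_Inter X A \<in> S" if A: "A \<subseteq> S" for A
    using A adj by (intro fixp) (auto simp: subset_open_Inter_iff hS sub open_Inter_lower subsetD)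
  interpret P: partial_order "opens X\<lparr>carrier := S\<rparr>"
    by (rule partial_order_subset_opens)
  have Int: "U \<inter> V \<in> S" if "U \<in> S" "V \<in> S" for U V
    using meets[of "{U, V}"] that open_Inter_pair[OF sub sub, of U V] by simp
  have meet: "U \<sqinter>\<^bsub>opens X\<lparr>carrier := S\<rparr>\<^esub> V = U \<inter> V" if "U \<in> S" "V \<in> S" for U V
    using that Int by (intro P.meet_eqI) auto
  have hInt: "h (U \<inter> V) = h U \<inter> h V" if "openin X U" "openin X V" for U V
    using h that meet[OF hS hS, OF that] by (simp add: frame_hom_def meet_opens)
  have imps: "open_imp X U V \<in> S" if U: "openin X U" and V: "V \<in> S" for U V
  proof (rule fixp)
    have "h (open_imp X U V) \<inter> U \<subseteq> h (open_imp X U V \<inter> U)"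
      using hInt[of "open_imp X U V" U] U up[OF U] by auto
    also have "\<dots> \<subseteq> V"
      using adj[of "open_imp X U V \<inter> U" V] U V by (simp add: openin_Int open_imp_Int)
    finally show "h (open_imp X U V) \<subseteq> open_imp X U V"
      using sub hS by (subst subset_open_imp_iff) auto
  qed simp
  show "sublocale_set X S"
    using sub meets imps by (auto simp: sublocale_set_def)
next
  assume S: "sublocale_set X S"
  note o = sublocale_set_openin[OF S]
  have "frame_hom (opens X) (opens X\<lparr>carrier := S\<rparr>) (nucleus X S)"
  proof (rule frame_homI)
    show "nucleus X S (\<Squnion>\<^bsub>opens X\<^esub>A) = \<Squnion>\<^bsub>opens X\<lparr>carrier := S\<rparr>\<^esub>(nucleus X S ` A)"
      if "A \<subseteq> carrier (opens X)" for A
    proof -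
      have A: "A \<subseteq> {U. openin X U}"
        using that by simp
      have "nucleus X S (\<Union>A) = nucleus X S (\<Union>(nucleus X S ` A))"
      proof
        have "\<Union>A \<subseteq> \<Union>(nucleus X S ` A)"
          using A nucleus_upper[of X _ S] by (intro Union_least) (blast intro: order_trans)
        then show "nucleus X S (\<Union>A) \<subseteq> nucleus X S (\<Union>(nucleus X S ` A))"
          by (intro nucleus_mono S openin_Union) auto
        have "nucleus X S U \<subseteq> nucleus X S (\<Union>A)" if "U \<in> A" for U
          using A that by (intro nucleus_mono S openin_Union) auto
        then show "nucleus X S (\<Union>(nucleus X S ` A)) \<subseteq> nucleus X S (\<Union>A)"
          by (intro nucleus_least nucleus_in S) (rule UN_least)
      qed
      moreover have "nucleus X S ` A \<subseteq> S"
        using nucleus_in[OF S] by auto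
      ultimately show ?thesis
        by (simp add: sup_opens[OF A] sup_sublocale_set[OF S])
    qed
    have "topspace X \<subseteq> nucleus X S (topspace X)"
      by (rule nucleus_upper) simp
    then show "nucleus X S \<top>\<^bsub>opens X\<^esub> = \<top>\<^bsub>opens X\<lparr>carrier := S\<rparr>\<^esub>"
      using openin_subset[OF openin_nucleus[of X S "topspace X"]]
      by (simp add: top_opens top_sublocale_set[OF S] subset_antisym)
    show "nucleus X S (U \<sqinter>\<^bsub>opens X\<^esub> V) = nucleus X S U \<sqinter>\<^bsub>opens X\<lparr>carrier := S\<rparr>\<^esub> nucleus X S V"
      if "U \<in> carrier (opens X)" "V \<in> carrier (opens X)" for U V
      using that nucleus_in[OF S]
      by (simp add: meet_opens meet_sublocale_set[OF S] nucleus_Int[OF S])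
  qed (simp_all add: frame_opens frame_sublocale_set[OF S] nucleus_in[OF S])
  then show "is_sublocale (opens X) S"
    unfolding is_sublocale_def using o
    by (intro conjI exI[of _ "nucleus X S"]) (auto simp: nucleus_le_iff)
qed

section \<open>The frame of sublocales\<close>

lemma open_imp_Int_right: "open_imp X W (U \<inter> V) = open_imp X W U \<inter> open_imp X W V"
proof
  have "open_imp X W U \<inter> open_imp X W V \<inter> W \<subseteq> U \<inter> V"
    using open_imp_Int[of X W U] open_imp_Int[of X W V] by blast
  then show "open_imp X W U \<inter> open_imp X W V \<subseteq> open_imp X W (U \<inter> V)"
    by (subst subset_open_imp_iff) (auto intro!: openin_Int)
next
  show "open_imp X W (U \<inter> V) \<subseteq> open_imp X W U \<inter> open_imp X W V"
    by (auto simp: open_imp_def)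
qed

lemma sublocale_set_Inter:
  assumes \<S>: "\<And>S. S \<in> \<S> \<Longrightarrow> sublocale_set X S"
  shows "sublocale_set X ({U. openin X U} \<inter> \<Inter>\<S>)"
  unfolding sublocale_set_def
proof (intro conjI ballI allI impI)
  fix A assume A: "A \<subseteq> {U. openin X U} \<inter> \<Inter>\<S>"
  have "open_Inter X A \<in> S" if "S \<in> \<S>" for S
    using A that by (intro sublocale_set_open_Inter \<S>) auto
  then show "open_Inter X A \<in> {U. openin X U} \<inter> \<Inter>\<S>"
    by simp
next
  fix U V assume UV: "openin X U" "V \<in> {U. openin X U} \<inter> \<Inter>\<S>"
  have "open_imp X U V \<in> S" if "S \<in> \<S>" for S
    using UV that by (intro sublocale_set_open_imp \<S>) auto
  then show "open_imp X U V \<in> {U. openin X U} \<inter> \<Inter>\<S>"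
    by simp
qed simp

text \<open>The join of two sublocales. It is again a sublocale because infima and implications act
  on the two factors separately.\<close>

definition sublocale_join :: "'a set set \<Rightarrow> 'a set set \<Rightarrow> 'a set set" where
  "sublocale_join S T = {U \<inter> V |U V. U \<in> S \<and> V \<in> T}"

lemma sublocale_joinI: "U \<in> S \<Longrightarrow> V \<in> T \<Longrightarrow> U \<inter> V \<in> sublocale_join S T"
  by (auto simp: sublocale_join_def)

lemma sublocale_joinE:
  assumes "W \<in> sublocale_join S T"
  obtains U V where "U \<in> S" "V \<in> T" "W = U \<inter> V"
  using assms by (auto simp: sublocale_join_def)

lemma sublocale_set_join:
  assumes S: "sublocale_set X S" and T: "sublocale_set X T"
  shows "sublocale_set X (sublocale_join S T)"
  unfolding sublocale_set_def
proof (intro conjI ballI allI impI)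
  show "openin X U" if "U \<in> sublocale_join S T" for U
    using that sublocale_set_openin[OF S] sublocale_set_openin[OF T]
    by (auto simp: sublocale_join_def)
  show "open_imp X U V \<in> sublocale_join S T" if "openin X U" "V \<in> sublocale_join S T" for U V
    using that(2) sublocale_set_open_imp[OF S that(1)] sublocale_set_open_imp[OF T that(1)]
    by (elim sublocale_joinE) (simp add: open_imp_Int_right sublocale_joinI)
  show "open_Inter X A \<in> sublocale_join S T" if A: "A \<subseteq> sublocale_join S T" for A
  proof -
    have "\<forall>W\<in>A. \<exists>U V. U \<in> S \<and> V \<in> T \<and> W = U \<inter> V"
      using A unfolding sublocale_join_def by blast
    then obtain s t where st: "\<And>W. W \<in> A \<Longrightarrow> s W \<in> S \<and> t W \<in> T \<and> W = s W \<inter> t W"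
      by metis
    have "open_Inter X A = open_Inter X (s ` A) \<inter> open_Inter X (t ` A)"
    proof
      have "open_Inter X A \<subseteq> s W" "open_Inter X A \<subseteq> t W" if "W \<in> A" for W
        using open_Inter_lower[OF that, of X] st[OF that] by blast+
      then show "open_Inter X A \<subseteq> open_Inter X (s ` A) \<inter> open_Inter X (t ` A)"
        by (simp add: subset_open_Inter_iff)
      have "open_Inter X (s ` A) \<subseteq> s W" "open_Inter X (t ` A) \<subseteq> t W" if "W \<in> A" for W
        using that by (auto intro!: open_Inter_lower)
      then have "open_Inter X (s ` A) \<inter> open_Inter X (t ` A) \<subseteq> W" if "W \<in> A" for W
        using st[OF that] that by blast
      then show "open_Inter X (s ` A) \<inter> open_Inter X (t ` A) \<subseteq> open_Inter X A"
        by (simp add: subset_open_Inter_iff openin_Int)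
    qed
    moreover have "open_Inter X (s ` A) \<in> S" "open_Inter X (t ` A) \<in> T"
      using st by (auto intro!: sublocale_set_open_Inter[OF S] sublocale_set_open_Inter[OF T])
    ultimately show ?thesis
      by (simp add: sublocale_joinI)
  qed
qed

lemma sublocale_join_upper:
  assumes "sublocale_set X S" "sublocale_set X T"
  shows "S \<subseteq> sublocale_join S T" "T \<subseteq> sublocale_join S T"
proof -
  note o = openin_subset[OF sublocale_set_openin[OF assms(1)]]
    openin_subset[OF sublocale_set_openin[OF assms(2)]]
  show "S \<subseteq> sublocale_join S T"
  proof
    fix U assume "U \<in> S"
    with o have "U = U \<inter> topspace X" by auto
    with \<open>U \<in> S\<close> show "U \<in> sublocale_join S T"
      using sublocale_set_topspace[OF assms(2)] by (auto simp: sublocale_join_def)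
  qed
  show "T \<subseteq> sublocale_join S T"
  proof
    fix U assume "U \<in> T"
    with o have "U = topspace X \<inter> U" by auto
    with \<open>U \<in> T\<close> show "U \<in> sublocale_join S T"
      using sublocale_set_topspace[OF assms(1)] by (auto simp: sublocale_join_def)
  qed
qed

lemma sublocale_join_least:
  "sublocale_set X R \<Longrightarrow> S \<subseteq> R \<Longrightarrow> T \<subseteq> R \<Longrightarrow> sublocale_join S T \<subseteq> R"
  by (auto simp: sublocale_join_def intro: sublocale_set_Int)

text \<open>The coframe law. If \<open>W = U \<inter> V\<close> with \<open>U \<in> S\<close> and \<open>V \<in> T\<close>, then \<open>W\<close> also factors as
  \<open>s \<inter> (s \<rightarrow> W)\<close> where \<open>s\<close> is the reflection of \<open>W\<close> into \<open>S\<close>. This factorization does not depend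
  on \<open>T\<close>, so its second factor lies in every \<open>T\<close> of the family.\<close>

lemma sublocale_join_Inter:
  assumes S: "sublocale_set X S" and \<T>: "\<And>T. T \<in> \<T> \<Longrightarrow> sublocale_set X T"
    and W: "openin X W" "\<And>T. T \<in> \<T> \<Longrightarrow> W \<in> sublocale_join S T"
  shows "W \<in> sublocale_join S ({U. openin X U} \<inter> \<Inter>\<T>)"
proof -
  let ?s = "nucleus X S W"
  let ?t = "open_imp X ?s W"
  have Ws: "W \<subseteq> ?s"
    using W(1) by (rule nucleus_upper)
  have "?t \<in> T" if T: "T \<in> \<T>" for T
  proof -
    from W(2)[OF T] obtain U V where UV: "U \<in> S" "V \<in> T" "W = U \<inter> V"
      by (auto simp: sublocale_join_def)
    have "?s \<subseteq> U"
      using UV by (intro nucleus_least) auto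
    \<comment> \<open>Hence \<open>W = ?s \<inter> V\<close>, and so \<open>?t\<close> is an implication with conclusion \<open>V\<close>.\<close>
    then have "W = ?s \<inter> V"
      using UV Ws by blast
    then have "?t = open_imp X ?s (?s \<inter> V)"
      by simp
    also have "\<dots> = open_imp X ?s V"
      unfolding open_imp_def by blast
    finally show "?t \<in> T"
      using sublocale_set_open_imp[OF \<T>[OF T] openin_nucleus UV(2)] by simp
  qed
  then have "?t \<in> {U. openin X U} \<inter> \<Inter>\<T>"
    by simp
  then have "?s \<inter> ?t \<in> sublocale_join S ({U. openin X U} \<inter> \<Inter>\<T>)"
    by (intro sublocale_joinI nucleus_in[OF S])
  moreover have "W = ?s \<inter> ?t"
    using Ws open_imp_Int[of X ?s W] subset_open_imp_iff[OF W(1), of ?s W] by blast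
  ultimately show ?thesis
    by simp
qed

text \<open>The order is reversed inclusion: suprema are intersections of sublocales, binary meets are
  joins of sublocales, and the top element is the trivial sublocale.\<close>

abbreviation Sl_op :: "'a topology \<Rightarrow> 'a set set gorder" where
  "Sl_op X \<equiv> sublocale_locale (opens X)"

lemma Sl_op_sel [simp]:
  "carrier (Sl_op X) = {S. sublocale_set X S}" "(.=\<^bsub>Sl_op X\<^esub>) = (=)"
  "S \<sqsubseteq>\<^bsub>Sl_op X\<^esub> T \<longleftrightarrow> T \<subseteq> S"
  by (auto simp: sublocale_locale_def Sl_def is_sublocale_iff)

lemma partial_order_Sl_op: "partial_order (Sl_op X)"
  by unfold_locales auto

lemma sublocale_set_singleton: "sublocale_set X {topspace X}"
proof -
  have "open_Inter X A = topspace X" if "A \<subseteq> {topspace X}" for A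
  proof (rule subset_antisym)
    show "topspace X \<subseteq> open_Inter X A"
      using that by (subst subset_open_Inter_iff) auto
  qed (simp add: openin_subset)
  moreover have "open_imp X U (topspace X) = topspace X" for U
    by (intro subset_antisym) (simp_all add: openin_subset subset_open_imp_iff)
  ultimately show ?thesis
    unfolding sublocale_set_def by simp
qed

lemma frame_Sl_op: "frame (Sl_op X)"
proof -
  interpret partial_order "Sl_op X"
    by (rule partial_order_Sl_op)
  show ?thesis
  proof (rule frame_criterion[where sg = "\<lambda>\<S>. {U. openin X U} \<inter> \<Inter>\<S>" and mt = sublocale_join])
    show "sublocale_join S ({U. openin X U} \<inter> \<Inter>\<T>)
        \<sqsubseteq>\<^bsub>Sl_op X\<^esub> {U. openin X U} \<inter> \<Inter>(sublocale_join S ` \<T>)"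
      if "S \<in> carrier (Sl_op X)" "\<T> \<subseteq> carrier (Sl_op X)" for S \<T>
      using that sublocale_join_Inter[of X S \<T>] by auto
    fix \<S> T
    assume \<S>: "\<S> \<subseteq> carrier (Sl_op X)"
    show "{U. openin X U} \<inter> \<Inter>\<S> \<in> carrier (Sl_op X)"
      using \<S> sublocale_set_Inter[of \<S> X] by auto
    show "T \<sqsubseteq>\<^bsub>Sl_op X\<^esub> {U. openin X U} \<inter> \<Inter>\<S>" if "T \<in> \<S>"
      using that by auto
    show "{U. openin X U} \<inter> \<Inter>\<S> \<sqsubseteq>\<^bsub>Sl_op X\<^esub> T"
      if "T \<in> carrier (Sl_op X)" "\<And>S. S \<in> \<S> \<Longrightarrow> S \<sqsubseteq>\<^bsub>Sl_op X\<^esub> T"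
      using that by (auto dest: sublocale_set_openin)
  next
    fix S T R
    assume "S \<in> carrier (Sl_op X)" "T \<in> carrier (Sl_op X)"
    then show "sublocale_join S T \<in> carrier (Sl_op X) \<and>
        sublocale_join S T \<sqsubseteq>\<^bsub>Sl_op X\<^esub> S \<and> sublocale_join S T \<sqsubseteq>\<^bsub>Sl_op X\<^esub> T"
      using sublocale_join_upper[of X S T] by (simp add: sublocale_set_join)
    show "R \<sqsubseteq>\<^bsub>Sl_op X\<^esub> sublocale_join S T"
      if "R \<in> carrier (Sl_op X)" "R \<sqsubseteq>\<^bsub>Sl_op X\<^esub> S" "R \<sqsubseteq>\<^bsub>Sl_op X\<^esub> T"
      using that sublocale_join_least[of X R S T] by simp
  qed
qed

lemma sup_Sl_op:
  assumes "\<S> \<subseteq> {S. sublocale_set X S}"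
  shows "\<Squnion>\<^bsub>Sl_op X\<^esub>\<S> = {U. openin X U} \<inter> \<Inter>\<S>"
proof (rule partial_order.sup_eqI[OF partial_order_Sl_op])
  show "{U. openin X U} \<inter> \<Inter>\<S> \<in> carrier (Sl_op X)"
    using assms sublocale_set_Inter[of \<S> X] by auto
  show "{U. openin X U} \<inter> \<Inter>\<S> \<sqsubseteq>\<^bsub>Sl_op X\<^esub> T"
    if "T \<in> carrier (Sl_op X)" "\<And>S. S \<in> \<S> \<Longrightarrow> S \<sqsubseteq>\<^bsub>Sl_op X\<^esub> T" for T
    using that sublocale_set_openin[of X T] by auto
qed (use assms in auto)

lemma join_Sl_op:
  assumes S: "sublocale_set X S" and T: "sublocale_set X T"
  shows "S \<squnion>\<^bsub>Sl_op X\<^esub> T = S \<inter> T"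
proof -
  have "S \<squnion>\<^bsub>Sl_op X\<^esub> T = {U. openin X U} \<inter> \<Inter>{S, T}"
    unfolding join_def using assms by (intro sup_Sl_op) simp
  also have "\<dots> = S \<inter> T"
    using sublocale_set_openin[OF S] by blast
  finally show ?thesis .
qed

lemma meet_Sl_op:
  assumes "sublocale_set X S" "sublocale_set X T"
  shows "S \<sqinter>\<^bsub>Sl_op X\<^esub> T = sublocale_join S T"
proof (rule partial_order.meet_eqI[OF partial_order_Sl_op])
  show "R \<sqsubseteq>\<^bsub>Sl_op X\<^esub> sublocale_join S T"
    if "R \<in> carrier (Sl_op X)" "R \<sqsubseteq>\<^bsub>Sl_op X\<^esub> S" "R \<sqsubseteq>\<^bsub>Sl_op X\<^esub> T" for R
    using that sublocale_join_least[of X R S T] by simp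
qed (use assms sublocale_join_upper[OF assms] in \<open>simp_all add: sublocale_set_join\<close>)

lemma top_Sl_op: "\<top>\<^bsub>Sl_op X\<^esub> = {topspace X}"
  by (rule partial_order.top_eqI[OF partial_order_Sl_op])
    (simp_all add: sublocale_set_singleton sublocale_set_topspace)

lemma bottom_Sl_op: "\<bottom>\<^bsub>Sl_op X\<^esub> = {U. openin X U}"
proof (rule partial_order.bottom_eqI[OF partial_order_Sl_op])
  show "{U. openin X U} \<sqsubseteq>\<^bsub>Sl_op X\<^esub> S" if "S \<in> carrier (Sl_op X)" for S
    using that sublocale_set_openin[of X S] by auto
qed (simp add: sublocale_set_opens)

lemma closed_sublocale_opens: "closed_sublocale (opens X) U = {V. openin X V \<and> U \<subseteq> V}"
  by (simp add: closed_sublocale_def)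

lemma sublocale_set_closed_sublocale:
  assumes U: "openin X U"
  shows "sublocale_set X (closed_sublocale (opens X) U)"
  unfolding sublocale_set_def closed_sublocale_opens
proof (intro conjI ballI allI impI)
  fix A assume "A \<subseteq> {V. openin X V \<and> U \<subseteq> V}"
  then have "U \<subseteq> open_Inter X A"
    by (subst subset_open_Inter_iff[OF U]) blast
  then show "open_Inter X A \<in> {V. openin X V \<and> U \<subseteq> V}"
    by simp
next
  fix V W assume "W \<in> {V. openin X V \<and> U \<subseteq> V}"
  then have "U \<subseteq> open_imp X V W"
    by (subst subset_open_imp_iff[OF U]) blast
  then show "open_imp X V W \<in> {V. openin X V \<and> U \<subseteq> V}"
    by simp
qed simp

lemma frame_hom_closed_sublocale: "frame_hom (opens X) (Sl_op X) (closed_sublocale (opens X))"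
proof (rule frame_homI)
  fix A assume "A \<subseteq> carrier (opens X)"
  then have A: "A \<subseteq> {U. openin X U}" by simp
  then have im: "closed_sublocale (opens X) ` A \<subseteq> {S. sublocale_set X S}"
    using sublocale_set_closed_sublocale by blast
  show "closed_sublocale (opens X) (\<Squnion>\<^bsub>opens X\<^esub>A)
      = \<Squnion>\<^bsub>Sl_op X\<^esub>(closed_sublocale (opens X) ` A)"
    unfolding sup_opens[OF A] sup_Sl_op[OF im] closed_sublocale_opens by blast
next
  have "{V. openin X V \<and> topspace X \<subseteq> V} = {topspace X}"
    using openin_subset[of X] openin_topspace[of X] by blast
  then show "closed_sublocale (opens X) \<top>\<^bsub>opens X\<^esub> = \<top>\<^bsub>Sl_op X\<^esub>"
    by (simp only: top_opens top_Sl_op closed_sublocale_opens)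
next
  fix U V assume "U \<in> carrier (opens X)" "V \<in> carrier (opens X)"
  then have U: "openin X U" and V: "openin X V" by auto
  have "{W. openin X W \<and> U \<inter> V \<subseteq> W}
      = sublocale_join {W. openin X W \<and> U \<subseteq> W} {W. openin X W \<and> V \<subseteq> W}" (is "?L = ?R")
  proof (intro equalityI subsetI)
    fix W assume W: "W \<in> ?L"
    then have "W = (W \<union> U) \<inter> (W \<union> V)"
      by auto
    then show "W \<in> ?R"
      using W U V sublocale_joinI[of "W \<union> U" _ "W \<union> V"] by (metis (no_types, lifting) Un_upper2 mem_Collect_eq openin_Un)
  next
    fix W assume "W \<in> ?R"
    then obtain P Q where "openin X P" "U \<subseteq> P" "openin X Q" "V \<subseteq> Q" "W = P \<inter> Q"
      by (metis (no_types, lifting) mem_Collect_eq sublocale_joinE)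
    then show "W \<in> ?L"
      by (auto intro: openin_Int)
  qed
  then show "closed_sublocale (opens X) (U \<sqinter>\<^bsub>opens X\<^esub> V)
      = closed_sublocale (opens X) U \<sqinter>\<^bsub>Sl_op X\<^esub> closed_sublocale (opens X) V"
    using meet_Sl_op[OF sublocale_set_closed_sublocale[OF U] sublocale_set_closed_sublocale[OF V]]
    by (simp only: meet_opens[OF U V] closed_sublocale_opens)
qed (simp_all add: frame_opens frame_Sl_op sublocale_set_closed_sublocale)

section \<open>Preimages of sublocales along homeomorphisms\<close>

lemma homeomorphic_maps_symD: "homeomorphic_maps X Y f g \<Longrightarrow> homeomorphic_maps Y X g f"
  by (metis homeomorphic_maps_sym)

lemma opens_map_openin:
  assumes "homeomorphic_maps X Y f g" "openin Y U"
  shows "openin X (opens_map X f U)"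
  unfolding opens_map_def using assms openin_continuous_map_preimage[of X Y f U]
  by (simp add: homeomorphic_maps_def)

lemma opens_map_inverse_subset:
  assumes fg: "homeomorphic_maps X Y f g" and U: "U \<subseteq> topspace X"
  shows "opens_map X f (opens_map Y g U) = U"
proof -
  have "f x \<in> topspace Y" "g (f x) = x" if "x \<in> topspace X" for x
    using fg that by (auto simp: homeomorphic_maps_def dest: continuous_map_image_subset_topspace)
  then show ?thesis
    using U by (auto simp: opens_map_def)
qed

lemma opens_map_inverse:
  "homeomorphic_maps X Y f g \<Longrightarrow> openin X U \<Longrightarrow> opens_map X f (opens_map Y g U) = U"
  by (intro opens_map_inverse_subset openin_subset)

lemma opens_map_compactin:
  assumes fg: "homeomorphic_maps X Y f g" and K: "compactin Y K"
  shows "compactin X (opens_map X f K)"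
proof -
  have "g y \<in> topspace X" "f (g y) = y" if "y \<in> topspace Y" for y
    using fg that by (auto simp: homeomorphic_maps_def dest: continuous_map_image_subset_topspace)
  moreover have "g (f x) = x" if "x \<in> topspace X" for x
    using fg that by (simp add: homeomorphic_maps_def)
  ultimately have "opens_map X f K = g ` K"
    using compactin_subset_topspace[OF K] by (force simp: opens_map_def)
  then show ?thesis
    using image_compactin[OF K, of X g] fg by (simp add: homeomorphic_maps_def)
qed

lemma opens_map_mono: "U \<subseteq> V \<Longrightarrow> opens_map X f U \<subseteq> opens_map X f V"
  by (auto simp: opens_map_def)

lemma opens_map_Int: "opens_map X f (U \<inter> V) = opens_map X f U \<inter> opens_map X f V"
  by (auto simp: opens_map_def)

text \<open>Preimage and preimage under the inverse are inverse monotone maps, hence adjoint on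
  both sides.\<close>

lemma opens_map_adjoint:
  assumes fg: "homeomorphic_maps X Y f g" and U: "openin Y U" and V: "openin X V"
  shows "opens_map X f U \<subseteq> V \<longleftrightarrow> U \<subseteq> opens_map Y g V"
    and "V \<subseteq> opens_map X f U \<longleftrightarrow> opens_map Y g V \<subseteq> U"
proof -
  have gf: "homeomorphic_maps Y X g f"
    using fg by (rule homeomorphic_maps_symD)
  note inv = opens_map_inverse[OF fg V] opens_map_inverse[OF gf U]
  show "opens_map X f U \<subseteq> V \<longleftrightarrow> U \<subseteq> opens_map Y g V"
    using opens_map_mono[of "opens_map X f U" V Y g] opens_map_mono[of U "opens_map Y g V" X f]
    unfolding inv by (rule iffI)
  show "V \<subseteq> opens_map X f U \<longleftrightarrow> opens_map Y g V \<subseteq> U"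
    using opens_map_mono[of V "opens_map X f U" Y g] opens_map_mono[of "opens_map Y g V" U X f]
    unfolding inv by (rule iffI)
qed

lemma opens_map_image_iff:
  assumes fg: "homeomorphic_maps X Y f g" and S: "\<And>V. V \<in> S \<Longrightarrow> openin Y V" and U: "openin X U"
  shows "U \<in> opens_map X f ` S \<longleftrightarrow> opens_map Y g U \<in> S"
proof -
  have gf: "homeomorphic_maps Y X g f"
    using fg by (rule homeomorphic_maps_symD)
  show ?thesis
  proof
    assume "U \<in> opens_map X f ` S"
    then obtain V where "V \<in> S" "U = opens_map X f V"
      by blast
    then show "opens_map Y g U \<in> S"
      using opens_map_inverse[OF gf, of V] S by simp
  next
    assume "opens_map Y g U \<in> S"
    then have "opens_map X f (opens_map Y g U) \<in> opens_map X f ` S"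
      by (rule imageI)
    then show "U \<in> opens_map X f ` S"
      by (simp only: opens_map_inverse[OF fg U])
  qed
qed

lemma opens_map_image_inverse:
  assumes "homeomorphic_maps X Y f g" "\<And>U. U \<in> S \<Longrightarrow> openin X U"
  shows "opens_map X f ` opens_map Y g ` S = S"
  using assms opens_map_inverse[of X Y f g] by (simp add: image_image)

text \<open>\<open>opens_map X f\<close> is an isomorphism of lattices of opens, so it respects the operations that
  define sublocales.\<close>

lemma sublocale_set_opens_map:
  assumes fg: "homeomorphic_maps X Y f g" and S: "sublocale_set Y S"
  shows "sublocale_set X (opens_map X f ` S)"
  unfolding sublocale_set_def
proof (intro conjI ballI allI impI)
  have gf: "homeomorphic_maps Y X g f"
    using fg by (rule homeomorphic_maps_symD)
  note So = sublocale_set_openin[OF S]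
  note fo = opens_map_openin[OF fg] and go = opens_map_openin[OF gf]
  note adj = opens_map_adjoint[OF fg]
  note mem = opens_map_image_iff[OF fg So]
  show "openin X U" if "U \<in> opens_map X f ` S" for U
    using that fo So by blast
  show "open_Inter X A \<in> opens_map X f ` S" if A: "A \<subseteq> opens_map X f ` S" for A
  proof -
    have Ao: "openin X U" if "U \<in> A" for U
      using that A fo So by blast
    have A': "opens_map Y g ` A \<subseteq> S"
      using A mem Ao by blast
    have "opens_map Y g (open_Inter X A) = open_Inter Y (opens_map Y g ` A)"
    proof
      have "opens_map Y g (open_Inter X A) \<subseteq> opens_map Y g U" if "U \<in> A" for U
        by (intro opens_map_mono open_Inter_lower that)
      then show "opens_map Y g (open_Inter X A) \<subseteq> open_Inter Y (opens_map Y g ` A)"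
        by (simp add: subset_open_Inter_iff go)
      have "opens_map X f (open_Inter Y (opens_map Y g ` A)) \<subseteq> U" if "U \<in> A" for U
        using that by (subst adj(1)[OF _ Ao[OF that]]) (auto intro!: open_Inter_lower)
      then show "open_Inter Y (opens_map Y g ` A) \<subseteq> opens_map Y g (open_Inter X A)"
        by (simp add: adj(1)[symmetric] subset_open_Inter_iff fo)
    qed
    then show ?thesis
      using sublocale_set_open_Inter[OF S A'] by (simp add: mem)
  qed
  show "open_imp X U W \<in> opens_map X f ` S" if U: "openin X U" and W: "W \<in> opens_map X f ` S" for U W
  proof -
    obtain V where V: "V \<in> S" "W = opens_map X f V"
      using W by blast
    have "opens_map Y g (open_imp X U W) = open_imp Y (opens_map Y g U) V"
    proof
      have "opens_map Y g (open_imp X U W \<inter> U) \<subseteq> V"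
        using open_imp_Int[of X U W] adj(2)[OF So[OF V(1)], of "open_imp X U W \<inter> U"] U
        unfolding V(2)[symmetric] by (simp add: openin_Int)
      then show "opens_map Y g (open_imp X U W) \<subseteq> open_imp Y (opens_map Y g U) V"
        by (simp add: subset_open_imp_iff go opens_map_Int)
      have "opens_map X f (open_imp Y (opens_map Y g U) V) \<inter> U
          = opens_map X f (open_imp Y (opens_map Y g U) V \<inter> opens_map Y g U)"
        by (simp add: opens_map_Int opens_map_inverse[OF fg U])
      also have "\<dots> \<subseteq> W"
        unfolding V(2) by (intro opens_map_mono open_imp_Int)
      finally show "open_imp Y (opens_map Y g U) V \<subseteq> opens_map Y g (open_imp X U W)"
        by (simp add: adj(1)[symmetric] subset_open_imp_iff fo)
    qed
    then show ?thesis
      using sublocale_set_open_imp[OF S go[OF U] V(1)] by (simp add: mem)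
  qed
qed

lemma direct_image_homeomorphic:
  assumes fg: "homeomorphic_maps X Y f g" and U: "openin X U"
  shows "direct_image (opens X) (opens Y) (opens_map X f) U = opens_map Y g U"
  unfolding direct_image_def
proof (rule partial_order.sup_eqI[OF partial_order_opens])
  have gf: "homeomorphic_maps Y X g f"
    using fg by (rule homeomorphic_maps_symD)
  show "opens_map Y g U \<in> carrier (opens Y)"
    using opens_map_openin[OF gf U] by simp
  show "V \<sqsubseteq>\<^bsub>opens Y\<^esub> opens_map Y g U"
    if "V \<in> {v \<in> carrier (opens Y). opens_map X f v \<sqsubseteq>\<^bsub>opens X\<^esub> U}" for V
    using that opens_map_adjoint(1)[OF fg _ U, of V] by auto
  show "opens_map Y g U \<sqsubseteq>\<^bsub>opens Y\<^esub> W"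
    if "\<And>V. V \<in> {v \<in> carrier (opens Y). opens_map X f v \<sqsubseteq>\<^bsub>opens X\<^esub> U} \<Longrightarrow> V \<sqsubseteq>\<^bsub>opens Y\<^esub> W" for W
    using that[of "opens_map Y g U"] opens_map_openin[OF gf U] opens_map_inverse[OF fg U] by simp
qed auto

text \<open>Since the direct image under \<open>f\<close> is the preimage under \<open>g\<close>, it takes \<open>T\<close> into \<open>S\<close> exactly when
  \<open>T\<close> is contained in the sublocale \<open>opens_map X f ` S\<close>, which is therefore the largest such
  \<open>T\<close>.\<close>

lemma sublocale_preimage_homeomorphic:
  assumes fg: "homeomorphic_maps X Y f g" and S: "sublocale_set Y S"
  shows "sublocale_preimage (opens X) (opens Y) (opens_map X f) S = opens_map X f ` S"
  unfolding sublocale_preimage_def is_sublocale_iff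
proof (rule partial_order.sup_eqI)
  have iff: "direct_image (opens X) (opens Y) (opens_map X f) ` T \<subseteq> S \<longleftrightarrow> T \<subseteq> opens_map X f ` S"
    if "sublocale_set X T" for T
  proof -
    have "direct_image (opens X) (opens Y) (opens_map X f) U \<in> S \<longleftrightarrow> U \<in> opens_map X f ` S"
      if "U \<in> T" for U
    proof -
      have "openin X U"
        using \<open>sublocale_set X T\<close> that by (rule sublocale_set_openin)
      then show ?thesis
        using opens_map_image_iff[OF fg sublocale_set_openin[OF S]] direct_image_homeomorphic[OF fg]
        by simp
    qed
    then show ?thesis
      by (simp add: image_subset_iff subset_eq[of T])
  qed
  show "partial_order (Sl (opens X))"
    by unfold_locales (auto simp: Sl_def)
  show "opens_map X f ` S \<in> carrier (Sl (opens X))"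
    using sublocale_set_opens_map[OF fg S] by (simp add: Sl_def is_sublocale_iff)
  fix T
  show "T \<sqsubseteq>\<^bsub>Sl (opens X)\<^esub> opens_map X f ` S"
    if "T \<in> {T. sublocale_set X T \<and> direct_image (opens X) (opens Y) (opens_map X f) ` T \<subseteq> S}"
    using that iff[of T] by (auto simp: Sl_def)
  show "opens_map X f ` S \<sqsubseteq>\<^bsub>Sl (opens X)\<^esub> T"
    if "\<And>R. R \<in> {R. sublocale_set X R \<and> direct_image (opens X) (opens Y) (opens_map X f) ` R \<subseteq> S}
      \<Longrightarrow> R \<sqsubseteq>\<^bsub>Sl (opens X)\<^esub> T"
    using that[of "opens_map X f ` S"] iff[OF sublocale_set_opens_map[OF fg S]]
      sublocale_set_opens_map[OF fg S] by (simp add: Sl_def)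
qed (simp add: Sl_def is_sublocale_iff subset_iff)

lemma frame_hom_sublocale_preimage:
  assumes fg: "homeomorphic_maps X Y f g"
  shows "frame_hom (Sl_op Y) (Sl_op X) (sublocale_preimage (opens X) (opens Y) (opens_map X f))"
proof (rule frame_hom_two_adjoints[where k = "(`) (opens_map Y g)"])
  have gf: "homeomorphic_maps Y X g f"
    using fg by (rule homeomorphic_maps_symD)
  show "sublocale_preimage (opens X) (opens Y) (opens_map X f) \<in> carrier (Sl_op Y) \<rightarrow> carrier (Sl_op X)"
    using sublocale_set_opens_map[OF fg] by (simp add: sublocale_preimage_homeomorphic[OF fg])
  show "(`) (opens_map Y g) \<in> carrier (Sl_op X) \<rightarrow> carrier (Sl_op Y)"
    using sublocale_set_opens_map[OF gf] by simp
  fix S T assume "S \<in> carrier (Sl_op Y)" "T \<in> carrier (Sl_op X)"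
  then have S: "sublocale_set Y S" and T: "sublocale_set X T"
    by auto
  have inv: "opens_map X f ` opens_map Y g ` T = T" "opens_map Y g ` opens_map X f ` S = S"
    using opens_map_image_inverse[OF fg sublocale_set_openin[OF T]]
      opens_map_image_inverse[OF gf sublocale_set_openin[OF S]] by simp_all
  show "sublocale_preimage (opens X) (opens Y) (opens_map X f) S \<sqsubseteq>\<^bsub>Sl_op X\<^esub> T
      \<longleftrightarrow> S \<sqsubseteq>\<^bsub>Sl_op Y\<^esub> opens_map Y g ` T"
    using inv image_mono[of T "opens_map X f ` S" "opens_map Y g"]
      image_mono[of "opens_map Y g ` T" S "opens_map X f"]
    by (auto simp: sublocale_preimage_homeomorphic[OF fg S])
  show "T \<sqsubseteq>\<^bsub>Sl_op X\<^esub> sublocale_preimage (opens X) (opens Y) (opens_map X f) S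
      \<longleftrightarrow> opens_map Y g ` T \<sqsubseteq>\<^bsub>Sl_op Y\<^esub> S"
    using inv image_mono[of "opens_map X f ` S" T "opens_map Y g"]
      image_mono[of S "opens_map Y g ` T" "opens_map X f"]
    by (auto simp: sublocale_preimage_homeomorphic[OF fg S])
qed (simp_all add: frame_Sl_op)

section \<open>The finite measures carried by compact sets\<close>

locale radon_space =
  fixes X :: "'a topology" and \<mu> :: "'a set \<Rightarrow> real"
  assumes Hausdorff: "Hausdorff_space X"
    and radon: "radon_valuation X \<mu>"
begin

lemma mu_nonneg: "compactin X C \<Longrightarrow> 0 \<le> \<mu> C"
  and mu_mono: "compactin X C \<Longrightarrow> compactin X D \<Longrightarrow> C \<subseteq> D \<Longrightarrow> \<mu> C \<le> \<mu> D"
  and mu_empty: "\<mu> {} = 0"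
  and mu_modular: "compactin X C \<Longrightarrow> compactin X D \<Longrightarrow> \<mu> C + \<mu> D = \<mu> (C \<union> D) + \<mu> (C \<inter> D)"
  using radon by (simp_all add: radon_valuation_def)

text \<open>A compact subset of \<open>U \<union> V\<close> splits into compact subsets of \<open>U\<close> and \<open>V\<close>, because its
  disjoint compact parts outside \<open>U\<close> and outside \<open>V\<close> have disjoint neighbourhoods.\<close>

lemma compact_split:
  assumes M: "compactin X M" and U: "openin X U" "openin X V" and MUV: "M \<subseteq> U \<union> V"
  obtains K L where "compactin X K" "compactin X L" "K \<subseteq> U" "L \<subseteq> V" "M = K \<union> L"
proof -
  have diff: "compactin X (M - W)" if "openin X W" for W
  proof -
    have "M - W = (topspace X - W) \<inter> M"
      using compactin_subset_topspace[OF M] by blast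
    then show ?thesis
      using closed_Int_compactin[OF closedin_diff[OF closedin_topspace that] M] by simp
  qed
  have "disjnt (M - U) (M - V)"
    using MUV by (auto simp: disjnt_def)
  then obtain A B where AB: "openin X A" "openin X B" "M - U \<subseteq> A" "M - V \<subseteq> B" "disjnt A B"
    using Hausdorff_space_compact_separation[OF Hausdorff diff[OF U(1)] diff[OF U(2)]] by metis
  show thesis
    by (rule that[of "M - A" "M - B"]) (use AB diff in \<open>auto simp: disjnt_def\<close>)
qed

text \<open>The measure on opens of the restriction of \<open>\<mu>\<close> to a compact set \<open>C\<close>. It is bounded by \<open>\<mu> C\<close>,
  so that values can be subtracted, even where every nonempty open set has infinite measure.\<close>

definition \<nu> :: "'a set \<Rightarrow> 'a set \<Rightarrow> real" where
  "\<nu> C U = Sup (\<mu> ` {K. compactin X K \<and> K \<subseteq> C \<inter> U})"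

context
  fixes C
  assumes C: "compactin X C"
begin

lemma mu_le_nu: "compactin X K \<Longrightarrow> K \<subseteq> C \<Longrightarrow> K \<subseteq> U \<Longrightarrow> \<mu> K \<le> \<nu> C U"
  unfolding \<nu>_def using C
  by (intro cSup_upper) (auto intro!: bdd_aboveI[where M = "\<mu> C"] mu_mono)

lemma nu_least:
  assumes "\<And>K. compactin X K \<Longrightarrow> K \<subseteq> C \<Longrightarrow> K \<subseteq> U \<Longrightarrow> \<mu> K \<le> b"
  shows "\<nu> C U \<le> b"
  unfolding \<nu>_def using assms
  by (intro cSup_least) (auto intro!: exI[of _ "{}"])

lemma nu_approx:
  assumes "0 < e"
  obtains K where "compactin X K" "K \<subseteq> C" "K \<subseteq> U" "\<nu> C U - e < \<mu> K"
  using nu_least[of U "\<nu> C U - e"] assms by (meson diff_less_eq leI less_add_same_cancel1 not_less)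

lemma nu_mono: "U \<subseteq> V \<Longrightarrow> \<nu> C U \<le> \<nu> C V"
  by (intro nu_least mu_le_nu) auto

lemma nu_nonneg: "0 \<le> \<nu> C U"
  using mu_le_nu[of "{}" U] by (simp add: mu_empty)

lemma nu_carrier: "C \<subseteq> U \<Longrightarrow> \<nu> C U = \<mu> C"
  using C by (intro antisym nu_least mu_le_nu mu_mono) auto

lemma nu_le: "\<nu> C U \<le> \<mu> C"
  using C by (intro nu_least mu_mono)

text \<open>For one inequality, take unions and intersections of compact sets; for the other, split a
  compact subset of \<open>U \<union> V\<close> and enlarge both pieces by a compact subset of \<open>U \<inter> V\<close>.\<close>

lemma nu_modular:
  assumes U: "openin X U" and V: "openin X V"
  shows "\<nu> C U + \<nu> C V = \<nu> C (U \<union> V) + \<nu> C (U \<inter> V)"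
proof (rule antisym; rule field_le_epsilon)
  fix e :: real assume e: "0 < e"
  obtain K where K: "compactin X K" "K \<subseteq> C" "K \<subseteq> U" "\<nu> C U - e/2 < \<mu> K"
    using nu_approx[of "e/2" U] e by auto
  obtain L where L: "compactin X L" "L \<subseteq> C" "L \<subseteq> V" "\<nu> C V - e/2 < \<mu> L"
    using nu_approx[of "e/2" V] e by auto
  have "\<mu> (K \<union> L) \<le> \<nu> C (U \<union> V)" "\<mu> (K \<inter> L) \<le> \<nu> C (U \<inter> V)"
    using K L compactin_Int[OF Hausdorff] by (auto intro!: mu_le_nu compactin_Un)
  then show "\<nu> C U + \<nu> C V \<le> \<nu> C (U \<union> V) + \<nu> C (U \<inter> V) + e"
    using mu_modular[OF K(1) L(1)] K(4) L(4) by linarith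
next
  fix e :: real assume e: "0 < e"
  obtain M where M: "compactin X M" "M \<subseteq> C" "M \<subseteq> U \<union> V" "\<nu> C (U \<union> V) - e/2 < \<mu> M"
    using nu_approx[of "e/2" "U \<union> V"] e by auto
  obtain P where P: "compactin X P" "P \<subseteq> C" "P \<subseteq> U \<inter> V" "\<nu> C (U \<inter> V) - e/2 < \<mu> P"
    using nu_approx[of "e/2" "U \<inter> V"] e by auto
  obtain K L where KL: "compactin X K" "compactin X L" "K \<subseteq> U" "L \<subseteq> V" "M = K \<union> L"
    using compact_split[OF M(1) U V M(3)] .
  have c: "compactin X (K \<union> P)" "compactin X (L \<union> P)"
    using KL P by (auto intro!: compactin_Un)
  have "\<mu> M \<le> \<mu> ((K \<union> P) \<union> (L \<union> P))" "\<mu> P \<le> \<mu> ((K \<union> P) \<inter> (L \<union> P))"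
    using c M P KL compactin_Int[OF Hausdorff] by (auto intro!: mu_mono compactin_Un)
  moreover have "\<mu> (K \<union> P) \<le> \<nu> C U" "\<mu> (L \<union> P) \<le> \<nu> C V"
    using c KL M P by (auto intro!: mu_le_nu)
  ultimately show "\<nu> C (U \<union> V) + \<nu> C (U \<inter> V) \<le> \<nu> C U + \<nu> C V + e"
    using mu_modular[OF c] M(4) P(4) by linarith
qed

text \<open>A compact set disjoint from \<open>K\<close> adds its full measure to \<open>\<mu> K\<close>.\<close>

lemma nu_minus_compact:
  assumes K: "compactin X K" "K \<subseteq> C" "K \<subseteq> U"
  shows "\<nu> C (U \<inter> (topspace X - K)) + \<mu> K \<le> \<nu> C U"
proof -
  have "\<nu> C (U \<inter> (topspace X - K)) \<le> \<nu> C U - \<mu> K"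
  proof (rule nu_least)
    fix M assume M: "compactin X M" "M \<subseteq> C" "M \<subseteq> U \<inter> (topspace X - K)"
    then have "M \<inter> K = {}" by auto
    then have "\<mu> M + \<mu> K = \<mu> (M \<union> K)"
      using mu_modular[OF M(1) K(1)] by (simp add: mu_empty)
    also have "\<dots> \<le> \<nu> C U"
      using M K by (intro mu_le_nu compactin_Un) auto
    finally show "\<mu> M \<le> \<nu> C U - \<mu> K" by simp
  qed
  then show ?thesis by simp
qed

text \<open>By compactness, a compact subset of a directed union lies in one of its members.\<close>

lemma nu_directed:
  assumes D: "\<And>U. U \<in> D \<Longrightarrow> openin X U" "D \<noteq> {}"
    and dir: "\<And>U V. U \<in> D \<Longrightarrow> V \<in> D \<Longrightarrow> \<exists>W\<in>D. U \<subseteq> W \<and> V \<subseteq> W"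
    and e: "0 < e"
  obtains U where "U \<in> D" "\<nu> C (\<Union>D) - e < \<nu> C U"
proof -
  obtain K where K: "compactin X K" "K \<subseteq> C" "K \<subseteq> \<Union>D" "\<nu> C (\<Union>D) - e < \<mu> K"
    using nu_approx[OF e] .
  obtain F where F: "finite F" "F \<subseteq> D" "K \<subseteq> \<Union>F"
    using compactinD[OF K(1) D(1) K(3)] by blast
  have "\<exists>W\<in>D. \<Union>F \<subseteq> W"
    using F(1,2)
  proof (induction F)
    case empty
    then show ?case using D(2) by auto
  next
    case (insert U F)
    then obtain W where "W \<in> D" "\<Union>F \<subseteq> W" by auto
    moreover obtain P where "P \<in> D" "U \<subseteq> P" "W \<subseteq> P"
      using dir[of U W] insert.prems \<open>W \<in> D\<close> by blast
    ultimately show ?case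
      by (intro bexI[of _ P]) auto
  qed
  then obtain W where "W \<in> D" "\<Union>F \<subseteq> W" by auto
  moreover from this have "K \<subseteq> W"
    using F(3) by blast
  ultimately show thesis
    using K(4) mu_le_nu[OF K(1,2), of W] by (intro that[of W]) auto
qed

end

text \<open>The part of \<open>V\<close> outside \<open>U\<close> gains measure when \<open>C\<close> grows. This does not follow from
  monotonicity of \<open>\<nu>\<close> in \<open>C\<close>; it is modularity of \<open>\<mu>\<close> applied to a compact \<open>K \<subseteq> C \<inter> V\<close> and a
  compact \<open>L \<subseteq> C' \<inter> U\<close>, since \<open>K \<inter> L \<subseteq> C \<inter> U\<close>.\<close>

lemma nu_diff_mono:
  assumes C: "compactin X C" "compactin X C'" "C \<subseteq> C'" and UV: "U \<subseteq> V"
  shows "\<nu> C V - \<nu> C U \<le> \<nu> C' V - \<nu> C' U"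
proof -
  have "\<nu> C V + \<nu> C' U \<le> \<nu> C' V + \<nu> C U"
  proof (rule field_le_epsilon)
    fix e :: real assume e: "0 < e"
    obtain K where K: "compactin X K" "K \<subseteq> C" "K \<subseteq> V" "\<nu> C V - e/2 < \<mu> K"
      using nu_approx[OF C(1), of "e/2" V] e by auto
    obtain L where L: "compactin X L" "L \<subseteq> C'" "L \<subseteq> U" "\<nu> C' U - e/2 < \<mu> L"
      using nu_approx[OF C(2), of "e/2" U] e by auto
    have "\<mu> (K \<union> L) \<le> \<nu> C' V" "\<mu> (K \<inter> L) \<le> \<nu> C U"
      using K L C UV compactin_Int[OF Hausdorff] by (auto intro!: mu_le_nu compactin_Un)
    then show "\<nu> C V + \<nu> C' U \<le> \<nu> C' V + \<nu> C U + e"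
      using mu_modular[OF K(1) L(1)] K(4) L(4) by linarith
  qed
  then show ?thesis by linarith
qed

section \<open>Open neighbourhoods of sublocales\<close>

text \<open>The opens \<open>U\<close> whose open sublocale contains \<open>S\<close>. That sublocale is the complement of the
  closed one, \<open>{V. U \<subseteq> V}\<close>, so the containment means that \<open>S\<close> meets the latter only in
  \<open>topspace X\<close>.\<close>

definition nbhds :: "'a set set \<Rightarrow> 'a set set" where
  "nbhds S = {U. openin X U \<and> (\<forall>V\<in>S. U \<subseteq> V \<longrightarrow> V = topspace X)}"

lemma nbhds_openin: "U \<in> nbhds S \<Longrightarrow> openin X U"
  by (simp add: nbhds_def)

lemma topspace_nbhds: "sublocale_set X S \<Longrightarrow> topspace X \<in> nbhds S"
  by (auto simp: nbhds_def dest!: sublocale_set_openin openin_subset)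

lemma nbhds_antimono: "S \<subseteq> T \<Longrightarrow> nbhds T \<subseteq> nbhds S"
  by (auto simp: nbhds_def)

lemma nbhds_upward: "U \<in> nbhds S \<Longrightarrow> U \<subseteq> V \<Longrightarrow> openin X V \<Longrightarrow> V \<in> nbhds S"
  by (auto simp: nbhds_def)

lemma nbhds_Int:
  assumes S: "sublocale_set X S" and U: "U \<in> nbhds S" and V: "V \<in> nbhds S"
  shows "U \<inter> V \<in> nbhds S"
  unfolding nbhds_def
proof (intro CollectI conjI ballI impI)
  have o: "openin X U" "openin X V"
    using U V by (auto dest: nbhds_openin)
  then show "openin X (U \<inter> V)" by (rule openin_Int)
  fix W assume W: "W \<in> S" "U \<inter> V \<subseteq> W"
  then have "V \<subseteq> open_imp X U W"
    using o by (auto simp: subset_open_imp_iff)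
  moreover have "open_imp X U W \<in> S"
    using S o W by (intro sublocale_set_open_imp) auto
  ultimately have "open_imp X U W = topspace X"
    using V by (auto simp: nbhds_def)
  then have "U \<subseteq> W"
    using open_imp_Int[of X U W] openin_subset[OF o(1)] by auto
  then show "W = topspace X"
    using U W by (auto simp: nbhds_def)
qed

lemma nbhds_join:
  assumes "sublocale_set X S" "sublocale_set X T"
  shows "nbhds (sublocale_join S T) = nbhds S \<inter> nbhds T"
proof
  show "nbhds (sublocale_join S T) \<subseteq> nbhds S \<inter> nbhds T"
    using sublocale_join_upper[OF assms] by (simp add: nbhds_antimono)
  show "nbhds S \<inter> nbhds T \<subseteq> nbhds (sublocale_join S T)"
  proof
    fix U assume U: "U \<in> nbhds S \<inter> nbhds T"
    have "W = topspace X" if "W \<in> sublocale_join S T" "U \<subseteq> W" for W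
    proof -
      obtain P Q where "P \<in> S" "Q \<in> T" "W = P \<inter> Q"
        using \<open>W \<in> sublocale_join S T\<close> by (rule sublocale_joinE)
      then show ?thesis
        using U \<open>U \<subseteq> W\<close> by (auto simp: nbhds_def)
    qed
    then show "U \<in> nbhds (sublocale_join S T)"
      using U by (auto simp: nbhds_def)
  qed
qed

section \<open>The support of a measure on a filter of opens\<close>

text \<open>For a filter base \<open>H\<close> of open sets, \<open>negligible C H V U\<close> says that \<open>V - U\<close> becomes null
  for \<open>\<nu> C\<close> after intersecting with the members of \<open>H\<close>. The difference below is the measure of
  \<open>(V \<inter> W) - U\<close>, written with opens only, where \<open>\<nu> C\<close> is defined.\<close>

definition negligible :: "'a set \<Rightarrow> 'a set set \<Rightarrow> 'a set \<Rightarrow> 'a set \<Rightarrow> bool" where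
  "negligible C H V U \<longleftrightarrow> (\<forall>e>0. \<exists>W\<in>H. \<nu> C (V \<inter> W \<union> U) - \<nu> C U < e)"

context
  fixes C H
  assumes C: "compactin X C"
    and H: "H \<noteq> {}" "\<And>W. W \<in> H \<Longrightarrow> openin X W"
      "\<And>V W. V \<in> H \<Longrightarrow> W \<in> H \<Longrightarrow> \<exists>P\<in>H. P \<subseteq> V \<inter> W"
begin

text \<open>The two differences are the measures of \<open>A - V\<close> and \<open>A - U\<close>.\<close>

lemma nu_diff_antimono:
  assumes "openin X A" "openin X U" "openin X V" "U \<subseteq> V"
  shows "\<nu> C (A \<union> V) - \<nu> C V \<le> \<nu> C (A \<union> U) - \<nu> C U"
proof -
  have "\<nu> C (A \<union> U) + \<nu> C V = \<nu> C (A \<union> U \<union> V) + \<nu> C ((A \<union> U) \<inter> V)"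
    using assms by (intro nu_modular C) auto
  moreover have "\<nu> C U \<le> \<nu> C ((A \<union> U) \<inter> V)"
    using assms by (intro nu_mono C) auto
  moreover have "A \<union> U \<union> V = A \<union> V"
    using assms by auto
  ultimately show ?thesis by simp
qed

lemma nu_diff_Int:
  assumes "openin X A" "openin X U"
  shows "\<nu> C (A \<union> U) - \<nu> C U = \<nu> C A - \<nu> C (A \<inter> U)"
  using nu_modular[OF C assms] by linarith

lemma negligible_refl: "negligible C H U U"
proof -
  have "U \<inter> W \<union> U = U" for W by auto
  then show ?thesis
    using H(1) by (auto simp: negligible_def)
qed

lemma negligible_antimono:
  assumes "negligible C H V U" "openin X V" "openin X U" "openin X U'" "U \<subseteq> U'"
  shows "negligible C H V U'"
  unfolding negligible_def
proof (intro allI impI)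
  fix e :: real assume "0 < e"
  then obtain W where W: "W \<in> H" "\<nu> C (V \<inter> W \<union> U) - \<nu> C U < e"
    using assms(1) by (auto simp: negligible_def)
  then show "\<exists>W\<in>H. \<nu> C (V \<inter> W \<union> U') - \<nu> C U' < e"
    using nu_diff_antimono[of "V \<inter> W" U U'] assms H(2)[OF W(1)]
    by (intro bexI[of _ W]) (auto simp: openin_Int)
qed

lemma negligible_common:
  assumes A: "negligible C H A U" and B: "negligible C H B V" and e: "0 < e"
  obtains W where "W \<in> H" "\<nu> C (A \<inter> W \<union> U) - \<nu> C U < e" "\<nu> C (B \<inter> W \<union> V) - \<nu> C V < e"
proof -
  obtain P where P: "P \<in> H" "\<nu> C (A \<inter> P \<union> U) - \<nu> C U < e"
    using A e by (auto simp: negligible_def)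
  obtain Q where Q: "Q \<in> H" "\<nu> C (B \<inter> Q \<union> V) - \<nu> C V < e"
    using B e by (auto simp: negligible_def)
  obtain W where W: "W \<in> H" "W \<subseteq> P \<inter> Q"
    using H(3)[OF P(1) Q(1)] by auto
  have "\<nu> C (A \<inter> W \<union> U) \<le> \<nu> C (A \<inter> P \<union> U)" "\<nu> C (B \<inter> W \<union> V) \<le> \<nu> C (B \<inter> Q \<union> V)"
    using W by (auto intro!: nu_mono C)
  then show thesis
    using W P Q by (intro that[of W]) auto
qed

lemma negligible_Un:
  assumes "negligible C H A U" "negligible C H B U" "openin X A" "openin X B" "openin X U"
  shows "negligible C H (A \<union> B) U"
  unfolding negligible_def
proof (intro allI impI)
  fix e :: real assume "0 < e"
  then obtain W where W: "W \<in> H" "\<nu> C (A \<inter> W \<union> U) - \<nu> C U < e/2" "\<nu> C (B \<inter> W \<union> U) - \<nu> C U < e/2"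
    using negligible_common[OF assms(1,2), of "e/2"] by auto
  have o: "openin X (A \<inter> W \<union> U)" "openin X (B \<inter> W \<union> U)"
    using assms H(2)[OF W(1)] by auto
  have "\<nu> C ((A \<inter> W \<union> U) \<union> (B \<inter> W \<union> U)) + \<nu> C U
      \<le> \<nu> C (A \<inter> W \<union> U) + \<nu> C (B \<inter> W \<union> U)"
    using nu_modular[OF C o] nu_mono[OF C, of U "(A \<inter> W \<union> U) \<inter> (B \<inter> W \<union> U)"] by auto
  moreover have "(A \<inter> W \<union> U) \<union> (B \<inter> W \<union> U) = (A \<union> B) \<inter> W \<union> U"
    by auto
  ultimately show "\<exists>W\<in>H. \<nu> C ((A \<union> B) \<inter> W \<union> U) - \<nu> C U < e"
    using W by (intro bexI[of _ W]) auto
qed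

lemma negligible_trans:
  assumes "negligible C H A V" "negligible C H V U" "openin X A" "openin X V" "openin X U"
  shows "negligible C H A U"
  unfolding negligible_def
proof (intro allI impI)
  fix e :: real assume "0 < e"
  then obtain W where W: "W \<in> H" "\<nu> C (A \<inter> W \<union> V) - \<nu> C V < e/2" "\<nu> C (V \<inter> W \<union> U) - \<nu> C U < e/2"
    using negligible_common[OF assms(1,2), of "e/2"] by auto
  have Wo: "openin X W" using H(2) W(1) .
  \<comment> \<open>Inside \<open>W\<close>, the set \<open>A - U\<close> is covered by \<open>A - V\<close> and \<open>V - U\<close>.\<close>
  have "\<nu> C (A \<inter> W \<union> (V \<inter> W \<union> U)) - \<nu> C (V \<inter> W \<union> U)
      = \<nu> C (A \<inter> W) - \<nu> C (A \<inter> W \<inter> (V \<inter> W \<union> U))"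
    using assms Wo by (intro nu_diff_Int) auto
  also have "\<dots> \<le> \<nu> C (A \<inter> W) - \<nu> C (A \<inter> W \<inter> V)"
    using nu_mono[OF C, of "A \<inter> W \<inter> V" "A \<inter> W \<inter> (V \<inter> W \<union> U)"] by auto
  also have "\<dots> = \<nu> C (A \<inter> W \<union> V) - \<nu> C V"
    using assms Wo by (intro nu_diff_Int[symmetric]) auto
  finally have "\<nu> C (A \<inter> W \<union> (V \<inter> W \<union> U)) - \<nu> C U < e"
    using W by linarith
  moreover have "\<nu> C (A \<inter> W \<union> U) \<le> \<nu> C (A \<inter> W \<union> (V \<inter> W \<union> U))"
    by (intro nu_mono C) auto
  ultimately show "\<exists>W\<in>H. \<nu> C (A \<inter> W \<union> U) - \<nu> C U < e"
    using W by (intro bexI[of _ W]) auto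
qed

text \<open>Negligibility survives directed unions because a single member of the union already has
  almost its full measure.\<close>

lemma negligible_Union:
  assumes D: "\<And>V. V \<in> D \<Longrightarrow> openin X V \<and> negligible C H V U" "D \<noteq> {}"
    and dir: "\<And>U V. U \<in> D \<Longrightarrow> V \<in> D \<Longrightarrow> \<exists>W\<in>D. U \<subseteq> W \<and> V \<subseteq> W" and U: "openin X U"
  shows "negligible C H (\<Union>D) U"
  unfolding negligible_def
proof (intro allI impI)
  fix e :: real assume e: "0 < e"
  obtain V where V: "V \<in> D" "\<nu> C (\<Union>D) - e/2 < \<nu> C V"
    using nu_directed[OF C _ D(2) dir, of "e/2"] D(1) e by auto
  obtain W where W: "W \<in> H" "\<nu> C (V \<inter> W \<union> U) - \<nu> C U < e/2"
    using D(1)[OF V(1)] e unfolding negligible_def by (meson half_gt_zero)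
  have o: "openin X V" "openin X W" "openin X (\<Union>D)"
    using V D(1) W H(2) by auto
  have "\<nu> C (\<Union>D \<inter> W \<union> (V \<inter> W \<union> U)) - \<nu> C (V \<inter> W \<union> U)
      = \<nu> C (\<Union>D \<inter> W) - \<nu> C (\<Union>D \<inter> W \<inter> (V \<inter> W \<union> U))"
    using o U by (intro nu_diff_Int) auto
  also have "\<dots> \<le> \<nu> C (\<Union>D \<inter> W) - \<nu> C (\<Union>D \<inter> W \<inter> V)"
    using nu_mono[OF C, of "\<Union>D \<inter> W \<inter> V" "\<Union>D \<inter> W \<inter> (V \<inter> W \<union> U)"] by auto
  also have "\<dots> = \<nu> C (\<Union>D \<inter> W \<union> V) - \<nu> C V"
    using o by (intro nu_diff_Int[symmetric]) auto
  also have "\<nu> C (\<Union>D \<inter> W \<union> V) \<le> \<nu> C (\<Union>D)"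
    using V by (intro nu_mono C) auto
  finally have "\<nu> C (\<Union>D \<inter> W \<union> (V \<inter> W \<union> U)) - \<nu> C U < e"
    using W V by linarith
  moreover have "\<nu> C (\<Union>D \<inter> W \<union> U) \<le> \<nu> C (\<Union>D \<inter> W \<union> (V \<inter> W \<union> U))"
    by (intro nu_mono C) auto
  ultimately show "\<exists>W\<in>H. \<nu> C (\<Union>D \<inter> W \<union> U) - \<nu> C U < e"
    using W by (intro bexI[of _ W]) auto
qed

text \<open>The sublocale of those opens that cannot be enlarged by a negligible amount: it
  carries what remains of \<open>\<nu> C\<close> along \<open>H\<close>.\<close>

definition support :: "'a set set" where
  "support = {U. openin X U \<and> (\<forall>V. openin X V \<longrightarrow> negligible C H V U \<longrightarrow> V \<subseteq> U)}"

lemma sublocale_set_support: "sublocale_set X support"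
  unfolding sublocale_set_def
proof (intro conjI ballI allI impI)
  fix A assume A: "A \<subseteq> support"
  have "V \<subseteq> open_Inter X A" if V: "openin X V" "negligible C H V (open_Inter X A)" for V
  proof -
    have "V \<subseteq> U" if "U \<in> A" for U
    proof -
      have "openin X U" using A that by (auto simp: support_def)
      then have "negligible C H V U"
        using V open_Inter_lower[OF that, of X] by (intro negligible_antimono[OF V(2)]) auto
      then show ?thesis
        using A that V by (auto simp: support_def)
    qed
    then show ?thesis
      using V by (simp add: subset_open_Inter_iff)
  qed
  then show "open_Inter X A \<in> support"
    by (simp add: support_def)
next
  fix P U assume P: "openin X P" and U: "U \<in> support"
  have Uo: "openin X U" using U by (simp add: support_def)
  have "V \<subseteq> open_imp X P U" if V: "openin X V" "negligible C H V (open_imp X P U)" for V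
  proof -
    have "negligible C H (V \<inter> P) U"
      unfolding negligible_def
    proof (intro allI impI)
      fix e :: real assume "0 < e"
      then obtain W where W: "W \<in> H" "\<nu> C (V \<inter> W \<union> open_imp X P U) - \<nu> C (open_imp X P U) < e"
        using V(2) by (auto simp: negligible_def)
      have Wo: "openin X W" using H(2) W(1) .
      have UI: "U \<subseteq> open_imp X P U"
        using Uo by (auto simp: subset_open_imp_iff)
      \<comment> \<open>\<open>P \<rightarrow> U\<close> and \<open>U\<close> have the same trace on \<open>P\<close>.\<close>
      have eq: "V \<inter> P \<inter> W \<inter> U = V \<inter> P \<inter> W \<inter> open_imp X P U"
        using UI open_imp_Int[of X P U] by auto
      have "\<nu> C (V \<inter> P \<inter> W \<union> U) - \<nu> C U = \<nu> C (V \<inter> P \<inter> W) - \<nu> C (V \<inter> P \<inter> W \<inter> U)"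
        using V P Wo Uo by (intro nu_diff_Int) auto
      also have "\<dots> = \<nu> C (V \<inter> P \<inter> W \<union> open_imp X P U) - \<nu> C (open_imp X P U)"
        unfolding eq using V P Wo by (intro nu_diff_Int[symmetric]) auto
      also have "\<dots> \<le> \<nu> C (V \<inter> W \<union> open_imp X P U) - \<nu> C (open_imp X P U)"
        using nu_mono[OF C, of "V \<inter> P \<inter> W \<union> open_imp X P U" "V \<inter> W \<union> open_imp X P U"] by auto
      finally show "\<exists>W\<in>H. \<nu> C (V \<inter> P \<inter> W \<union> U) - \<nu> C U < e"
        using W by (intro bexI[of _ W]) auto
    qed
    then have "V \<inter> P \<subseteq> U"
      using U V P by (auto simp: support_def)
    then show ?thesis
      using V by (simp add: subset_open_imp_iff)
  qed
  then show "open_imp X P U \<in> support"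
    by (simp add: support_def)
qed (simp add: support_def)

text \<open>Let \<open>J\<close> be the reflection of \<open>U\<close> into \<open>S\<close>. For every compact \<open>K \<subseteq> C \<inter> J\<close>, the open set
  \<open>U \<union> (topspace X - K)\<close> is a neighbourhood of \<open>S\<close>, and outside \<open>U\<close> it meets \<open>J\<close> only in points of
  \<open>J - K\<close>. As \<open>\<mu> K\<close> can be chosen close to \<open>\<nu> C J\<close>, the set \<open>J\<close> is negligible over \<open>U\<close>. If \<open>U\<close>
  belongs to the support, this forces \<open>J = U\<close>.\<close>

lemma support_subset:
  assumes S: "sublocale_set X S" and SH: "nbhds S \<subseteq> H"
  shows "support \<subseteq> S"
proof
  fix U assume U: "U \<in> support"
  then have Uo: "openin X U" by (simp add: support_def)
  let ?J = "nucleus X S U"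
  have UJ: "U \<subseteq> ?J" using Uo by (rule nucleus_upper)
  have "negligible C H ?J U"
    unfolding negligible_def
  proof (intro allI impI)
    fix e :: real assume e: "0 < e"
    obtain K where K: "compactin X K" "K \<subseteq> C" "K \<subseteq> ?J" "\<nu> C ?J - e < \<mu> K"
      using nu_approx[OF C e] .
    let ?L = "topspace X - K"
    have Lo: "openin X ?L"
      using compactin_imp_closedin[OF Hausdorff K(1)] by (rule openin_diff[OF openin_topspace])
    \<comment> \<open>A member of \<open>S\<close> above \<open>U\<close> contains \<open>?J\<close>, hence \<open>K\<close>.\<close>
    have "V = topspace X" if V: "V \<in> S" "U \<union> ?L \<subseteq> V" for V
    proof -
      have "?J \<subseteq> V" using V by (intro nucleus_least) auto
      then show ?thesis
        using V K(3) openin_subset[OF sublocale_set_openin[OF S V(1)]] by auto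
    qed
    then have "U \<union> ?L \<in> nbhds S"
      using Uo Lo unfolding nbhds_def by (intro CollectI conjI ballI impI openin_Un)
    then have W: "U \<union> ?L \<in> H"
      using SH by blast
    have "\<nu> C (?J \<inter> ?L) + \<mu> K \<le> \<nu> C ?J"
      using K by (intro nu_minus_compact C)
    then have small: "\<nu> C (?J \<inter> ?L) < e"
      using K(4) by linarith
    have "\<nu> C (?J \<inter> ?L) + \<nu> C U \<ge> \<nu> C (?J \<inter> ?L \<union> U)"
      using nu_modular[OF C, of "?J \<inter> ?L" U] nu_nonneg[OF C, of "?J \<inter> ?L \<inter> U"] Lo Uo
      by (simp add: openin_Int)
    moreover have "?J \<inter> (U \<union> ?L) \<union> U = ?J \<inter> ?L \<union> U"
      by auto
    ultimately show "\<exists>W\<in>H. \<nu> C (?J \<inter> W \<union> U) - \<nu> C U < e"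
      using W small by (intro bexI[of _ "U \<union> ?L"]) auto
  qed
  then have "?J \<subseteq> U"
    using U by (simp add: support_def)
  then show "U \<in> S"
    using UJ nucleus_in[OF S, of U] by (simp add: subset_antisym)
qed

text \<open>The largest open set that is negligible over \<open>U\<close> belongs to the support and contains \<open>U\<close>. If
  \<open>U\<close> is a neighbourhood of the support, that set is the whole space, and so some member \<open>W\<close> of
  \<open>H\<close> has little measure outside \<open>U\<close>.\<close>

lemma nbhds_support_nu:
  assumes U: "U \<in> nbhds support" and e: "0 < e"
  obtains W where "W \<in> H" "\<nu> C W < \<nu> C U + e"
proof -
  have Uo: "openin X U" using U by (rule nbhds_openin)
  let ?D = "{V. openin X V \<and> negligible C H V U}"
  have UD: "U \<in> ?D" using Uo negligible_refl by simp
  have neg: "negligible C H (\<Union>?D) U"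
  proof (rule negligible_Union[OF _ _ _ Uo])
    fix V W assume "V \<in> ?D" "W \<in> ?D"
    then have "V \<union> W \<in> ?D"
      using Uo by (auto intro: negligible_Un)
    then show "\<exists>P\<in>?D. V \<subseteq> P \<and> W \<subseteq> P" by blast
  qed (use UD in auto)
  have Do: "openin X (\<Union>?D)" by auto
  have "\<Union>?D \<in> support"
    unfolding support_def
  proof (intro CollectI conjI allI impI)
    fix V assume "openin X V" "negligible C H V (\<Union>?D)"
    then have "V \<in> ?D"
      using negligible_trans[OF _ neg _ Do Uo] by simp
    then show "V \<subseteq> \<Union>?D" by blast
  qed (rule Do)
  moreover have "U \<subseteq> \<Union>?D" using UD by blast
  ultimately have "\<Union>?D = topspace X"
    using U unfolding nbhds_def by blast
  then have "negligible C H (topspace X) U"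
    using neg by simp
  then obtain W where W: "W \<in> H" "\<nu> C (topspace X \<inter> W \<union> U) - \<nu> C U < e"
    using e unfolding negligible_def by blast
  have "\<nu> C W \<le> \<nu> C (topspace X \<inter> W \<union> U)"
    using openin_subset[OF H(2)[OF W(1)]] by (intro nu_mono C) auto
  then show thesis
    using W by (intro that[of W]) auto
qed

end

section \<open>Outer measure of sublocales\<close>

text \<open>The continuity property behind both additivity and directed continuity. The support is
  contained in every member of the family, hence in the intersection, so \<open>U\<close> is a neighbourhood of
  the support.\<close>

lemma nbhds_Inter_approx:
  assumes C: "compactin X C"
    and H: "H \<noteq> {}" "\<And>W. W \<in> H \<Longrightarrow> openin X W"
      "\<And>V W. V \<in> H \<Longrightarrow> W \<in> H \<Longrightarrow> \<exists>P\<in>H. P \<subseteq> V \<inter> W"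
    and \<S>: "\<And>S. S \<in> \<S> \<Longrightarrow> sublocale_set X S" "\<And>S. S \<in> \<S> \<Longrightarrow> nbhds S \<subseteq> H"
    and U: "U \<in> nbhds ({U. openin X U} \<inter> \<Inter>\<S>)" and e: "0 < e"
  obtains W where "W \<in> H" "\<nu> C W < \<nu> C U + e"
proof -
  have "support C H \<subseteq> S" if "S \<in> \<S>" for S
    using support_subset[OF C H \<S>(1)[OF that] \<S>(2)[OF that]] .
  moreover have "support C H \<subseteq> {U. openin X U}"
    using sublocale_set_openin[OF sublocale_set_support[OF C H]] by blast
  ultimately have "U \<in> nbhds (support C H)"
    using U nbhds_antimono[of "support C H" "{U. openin X U} \<inter> \<Inter>\<S>"] by blast
  then show thesis
    using nbhds_support_nu[OF C H _ e] that by blast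
qed

definition outer :: "'a set \<Rightarrow> 'a set set \<Rightarrow> real" where
  "outer C S = Inf (\<nu> C ` nbhds S)"

lemma outer_le: "compactin X C \<Longrightarrow> U \<in> nbhds S \<Longrightarrow> outer C S \<le> \<nu> C U"
  unfolding outer_def by (intro cInf_lower) (auto intro!: bdd_belowI[where m = 0] nu_nonneg)

lemma outer_greatest:
  assumes "sublocale_set X S" "\<And>U. U \<in> nbhds S \<Longrightarrow> b \<le> \<nu> C U"
  shows "b \<le> outer C S"
  unfolding outer_def using assms topspace_nbhds[OF assms(1)] by (intro cInf_greatest) auto

lemma outer_approx:
  assumes "sublocale_set X S" "0 < e"
  obtains U where "U \<in> nbhds S" "\<nu> C U < outer C S + e"
  using outer_greatest[OF assms(1), of "outer C S + e" C] assms(2)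
  by (meson less_add_same_cancel1 not_less)

lemma outer_mono:
  "compactin X C \<Longrightarrow> sublocale_set X T \<Longrightarrow> S \<subseteq> T \<Longrightarrow> outer C S \<le> outer C T"
  using nbhds_antimono[of S T] by (intro outer_greatest outer_le) auto

lemma outer_le_mu: "compactin X C \<Longrightarrow> sublocale_set X S \<Longrightarrow> outer C S \<le> \<mu> C"
  using outer_le[OF _ topspace_nbhds, of C S] nu_le[of C "topspace X"] by linarith

lemma sublocale_set_inter:
  assumes "sublocale_set X S" "sublocale_set X T"
  shows "sublocale_set X (S \<inter> T)"
  using assms by (simp add: sublocale_set_def)

text \<open>Neighbourhoods of \<open>S\<close> and \<open>T\<close> have as union a neighbourhood of the join and as intersection
  one of \<open>S \<inter> T\<close>, which gives one inequality. For the other, a neighbourhood of \<open>S \<inter> T\<close> is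
  approximated by such an intersection, and both factors are cut down to a neighbourhood \<open>Z\<close> of
  the join.\<close>

lemma outer_modular:
  assumes C: "compactin X C" and S: "sublocale_set X S" and T: "sublocale_set X T"
  shows "outer C S + outer C T = outer C (sublocale_join S T) + outer C (S \<inter> T)"
proof (rule antisym; rule field_le_epsilon)
  note join = sublocale_set_join[OF S T] and Int = sublocale_set_inter[OF S T]
  fix e :: real assume e: "0 < e"
  obtain Z where Z: "Z \<in> nbhds (sublocale_join S T)" "\<nu> C Z < outer C (sublocale_join S T) + e/3"
    using outer_approx[OF join, of "e/3" C] e by auto
  obtain Y where Y: "Y \<in> nbhds (S \<inter> T)" "\<nu> C Y < outer C (S \<inter> T) + e/3"
    using outer_approx[OF Int, of "e/3" C] e by auto
  let ?H = "{U \<inter> V |U V. U \<in> nbhds S \<and> V \<in> nbhds T}"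
  obtain W where W: "W \<in> ?H" "\<nu> C W < \<nu> C Y + e/3"
  proof (rule nbhds_Inter_approx[OF C, of ?H "{S, T}" Y "e/3"])
    show "?H \<noteq> {}"
      using topspace_nbhds[OF S] topspace_nbhds[OF T] by blast
    show "openin X W" if "W \<in> ?H" for W
      using that by (auto dest: nbhds_openin intro!: openin_Int)
    show "\<exists>P\<in>?H. P \<subseteq> V \<inter> W" if V: "V \<in> ?H" and W: "W \<in> ?H" for V W
    proof -
      obtain A B where A: "A \<in> nbhds S" "B \<in> nbhds T" "V = A \<inter> B"
        using V by blast
      obtain A' B' where A': "A' \<in> nbhds S" "B' \<in> nbhds T" "W = A' \<inter> B'"
        using W by blast
      have "(A \<inter> A') \<inter> (B \<inter> B') \<in> ?H"
        using nbhds_Int[OF S A(1) A'(1)] nbhds_Int[OF T A(2) A'(2)] by blast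
      moreover have "(A \<inter> A') \<inter> (B \<inter> B') \<subseteq> V \<inter> W"
        using A(3) A'(3) by blast
      ultimately show ?thesis by blast
    qed
    show "nbhds R \<subseteq> ?H" if "R \<in> {S, T}" for R
    proof
      fix U assume U: "U \<in> nbhds R"
      then have "U = U \<inter> topspace X" "U = topspace X \<inter> U"
        using openin_subset[OF nbhds_openin[OF U]] by auto
      then show "U \<in> ?H"
        using U that topspace_nbhds[OF S] topspace_nbhds[OF T] by blast
    qed
    have "{U. openin X U} \<inter> \<Inter>{S, T} = S \<inter> T"
      using sublocale_set_openin[OF S] by auto
    then show "Y \<in> nbhds ({U. openin X U} \<inter> \<Inter>{S, T})"
      using Y(1) by simp
  qed (use S T e in auto)
  then obtain U V where UV: "U \<in> nbhds S" "V \<in> nbhds T" "W = U \<inter> V"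
    by blast
  have Z': "Z \<in> nbhds S" "Z \<in> nbhds T"
    using Z(1) nbhds_join[OF S T] by auto
  have UZ: "U \<inter> Z \<in> nbhds S" and VZ: "V \<inter> Z \<in> nbhds T"
    using nbhds_Int[OF S UV(1) Z'(1)] nbhds_Int[OF T UV(2) Z'(2)] .
  have "\<nu> C (U \<inter> Z) + \<nu> C (V \<inter> Z) = \<nu> C (U \<inter> Z \<union> V \<inter> Z) + \<nu> C (U \<inter> Z \<inter> (V \<inter> Z))"
    using UZ VZ by (intro nu_modular C nbhds_openin)
  moreover have "\<nu> C (U \<inter> Z \<union> V \<inter> Z) \<le> \<nu> C Z" "\<nu> C (U \<inter> Z \<inter> (V \<inter> Z)) \<le> \<nu> C W"
    using UV(3) by (auto intro!: nu_mono[OF C])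
  ultimately show "outer C S + outer C T \<le> outer C (sublocale_join S T) + outer C (S \<inter> T) + e"
    using outer_le[OF C UZ] outer_le[OF C VZ] Z(2) Y(2) W(2) by linarith
next
  note Int = sublocale_set_inter[OF S T]
  fix e :: real assume e: "0 < e"
  obtain U where U: "U \<in> nbhds S" "\<nu> C U < outer C S + e/2"
    using outer_approx[OF S, of "e/2" C] e by auto
  obtain V where V: "V \<in> nbhds T" "\<nu> C V < outer C T + e/2"
    using outer_approx[OF T, of "e/2" C] e by auto
  have o: "openin X U" "openin X V"
    using U V by (auto dest: nbhds_openin)
  have "U \<union> V \<in> nbhds (sublocale_join S T)"
    unfolding nbhds_join[OF S T] using o
    by (intro IntI nbhds_upward[OF U(1)] nbhds_upward[OF V(1)]) auto
  moreover have "U \<inter> V \<in> nbhds (S \<inter> T)"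
    using nbhds_antimono[of "S \<inter> T" S] nbhds_antimono[of "S \<inter> T" T] U V
    by (intro nbhds_Int[OF Int]) auto
  ultimately have "outer C (sublocale_join S T) \<le> \<nu> C (U \<union> V)" "outer C (S \<inter> T) \<le> \<nu> C (U \<inter> V)"
    by (auto intro: outer_le[OF C])
  then show "outer C (sublocale_join S T) + outer C (S \<inter> T) \<le> outer C S + outer C T + e"
    using nu_modular[OF C o] U(2) V(2) by linarith
qed

lemma outer_opens: "compactin X C \<Longrightarrow> outer C {U. openin X U} = \<mu> C"
proof (rule antisym)
  assume C: "compactin X C"
  show "outer C {U. openin X U} \<le> \<mu> C"
    using C sublocale_set_opens by (rule outer_le_mu)
  have "\<mu> C \<le> \<nu> C U" if "U \<in> nbhds {U. openin X U}" for U
  proof -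
    have "U = topspace X"
      using that by (auto simp: nbhds_def)
    then show ?thesis
      using nu_carrier[OF C, of U] compactin_subset_topspace[OF C] by simp
  qed
  then show "\<mu> C \<le> outer C {U. openin X U}"
    by (intro outer_greatest sublocale_set_opens)
qed

text \<open>Neighbourhoods of the closed sublocale are the opens that cover the space together with
  \<open>U\<close>; complements of compact subsets of \<open>U\<close> have nearly the smallest measure among them.\<close>

lemma outer_closed_sublocale:
  assumes C: "compactin X C" and U: "openin X U"
  shows "outer C (closed_sublocale (opens X) U) = \<mu> C - \<nu> C U"
proof (rule antisym)
  have top: "\<nu> C (topspace X) = \<mu> C"
    using nu_carrier[OF C] compactin_subset_topspace[OF C] by simp
  show "outer C (closed_sublocale (opens X) U) \<le> \<mu> C - \<nu> C U"
  proof (rule field_le_epsilon)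
    fix e :: real assume e: "0 < e"
    obtain K where K: "compactin X K" "K \<subseteq> C" "K \<subseteq> U" "\<nu> C U - e < \<mu> K"
      using nu_approx[OF C e] .
    have "openin X (topspace X - K)"
      using compactin_imp_closedin[OF Hausdorff K(1)] by (rule openin_diff[OF openin_topspace])
    then have "topspace X - K \<in> nbhds (closed_sublocale (opens X) U)"
      using K(3) unfolding nbhds_def closed_sublocale_opens by (auto dest: openin_subset)
    then have "outer C (closed_sublocale (opens X) U) \<le> \<nu> C (topspace X \<inter> (topspace X - K))"
      using outer_le[OF C] by (simp add: Int_absorb1)
    then show "outer C (closed_sublocale (opens X) U) \<le> \<mu> C - \<nu> C U + e"
      using nu_minus_compact[OF C K(1,2) compactin_subset_topspace[OF K(1)]] K(4) top by linarith
  qed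
  show "\<mu> C - \<nu> C U \<le> outer C (closed_sublocale (opens X) U)"
  proof (rule outer_greatest)
    fix V assume V: "V \<in> nbhds (closed_sublocale (opens X) U)"
    then have Vo: "openin X V" by (rule nbhds_openin)
    then have "V \<union> U = topspace X"
      using V U unfolding nbhds_def closed_sublocale_opens by auto
    then show "\<mu> C - \<nu> C U \<le> \<nu> C V"
      using nu_modular[OF C Vo U] nu_nonneg[OF C, of "V \<inter> U"] top by simp
  qed (rule sublocale_set_closed_sublocale[OF U])
qed

text \<open>This makes the supremum over \<open>C\<close> in the definition of the measure a directed one, which is
  what additivity needs.\<close>

lemma mu_minus_outer_mono:
  assumes C: "compactin X C" "compactin X C'" "C \<subseteq> C'" and S: "sublocale_set X S"
  shows "\<mu> C - outer C S \<le> \<mu> C' - outer C' S"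
proof -
  have "outer C' S - (\<mu> C' - \<mu> C) \<le> outer C S"
  proof (rule outer_greatest[OF S])
    fix U assume U: "U \<in> nbhds S"
    have "\<nu> C (topspace X) - \<nu> C U \<le> \<nu> C' (topspace X) - \<nu> C' U"
      using openin_subset[OF nbhds_openin[OF U]] by (rule nu_diff_mono[OF C])
    then show "outer C' S - (\<mu> C' - \<mu> C) \<le> \<nu> C U"
      using outer_le[OF C(2) U] nu_carrier[OF C(1) compactin_subset_topspace[OF C(1)]]
        nu_carrier[OF C(2) compactin_subset_topspace[OF C(2)]] by linarith
  qed
  then show ?thesis by simp
qed

section \<open>The measure on the locale of sublocales\<close>

text \<open>A larger element of the reversed order is a smaller sublocale, so the measure of \<open>S\<close> has to be
  the mass outside \<open>S\<close>. This mass is computed inside each compact \<open>C\<close>, where the total \<open>\<mu> C\<close> is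
  finite.\<close>

definition sublocale_measure :: "'a set set \<Rightarrow> ennreal" where
  "sublocale_measure S = (SUP C\<in>{C. compactin X C}. ennreal (\<mu> C - outer C S))"

lemma sublocale_measure_upper:
  "compactin X C \<Longrightarrow> ennreal (\<mu> C - outer C S) \<le> sublocale_measure S"
  unfolding sublocale_measure_def by (rule SUP_upper) simp

lemma sublocale_measure_antimono:
  assumes T: "sublocale_set X T" and ST: "S \<subseteq> T"
  shows "sublocale_measure T \<le> sublocale_measure S"
  unfolding sublocale_measure_def
proof (rule SUP_mono)
  fix C assume "C \<in> {C. compactin X C}"
  then show "\<exists>D\<in>{C. compactin X C}. ennreal (\<mu> C - outer C T) \<le> ennreal (\<mu> D - outer D S)"
    using outer_mono[OF _ T ST, of C] by (intro bexI[of _ C] ennreal_leI) auto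
qed

lemma sublocale_measure_modular:
  assumes S: "sublocale_set X S" and T: "sublocale_set X T"
  shows "sublocale_measure S + sublocale_measure T
      = sublocale_measure (S \<inter> T) + sublocale_measure (sublocale_join S T)"
proof -
  have add: "sublocale_measure P + sublocale_measure Q
      = (SUP C\<in>{C. compactin X C}. ennreal ((\<mu> C - outer C P) + (\<mu> C - outer C Q)))"
    if P: "sublocale_set X P" and Q: "sublocale_set X Q" for P Q
  proof -
    have "(SUP C\<in>{C. compactin X C}. ennreal (\<mu> C - outer C P) + ennreal (\<mu> C - outer C Q))
        = sublocale_measure P + sublocale_measure Q"
      unfolding sublocale_measure_def
    proof (rule SUP_add_directed_ennreal)
      fix C D assume "C \<in> {C. compactin X C}" "D \<in> {C. compactin X C}"
      then have CD: "compactin X C" "compactin X D" "compactin X (C \<union> D)"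
        by (auto intro: compactin_Un)
      then show "\<exists>E\<in>{C. compactin X C}. ennreal (\<mu> C - outer C P) + ennreal (\<mu> D - outer D Q)
          \<le> ennreal (\<mu> E - outer E P) + ennreal (\<mu> E - outer E Q)"
        using mu_minus_outer_mono[OF CD(1) CD(3) _ P] mu_minus_outer_mono[OF CD(2) CD(3) _ Q]
        by (intro bexI[of _ "C \<union> D"] add_mono ennreal_leI) auto
    qed
    moreover have "(SUP C\<in>{C. compactin X C}. ennreal (\<mu> C - outer C P) + ennreal (\<mu> C - outer C Q))
        = (SUP C\<in>{C. compactin X C}. ennreal ((\<mu> C - outer C P) + (\<mu> C - outer C Q)))"
    proof (rule SUP_cong[OF refl])
      fix C assume "C \<in> {C. compactin X C}"
      then show "ennreal (\<mu> C - outer C P) + ennreal (\<mu> C - outer C Q)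
          = ennreal ((\<mu> C - outer C P) + (\<mu> C - outer C Q))"
        using outer_le_mu[of C P] outer_le_mu[of C Q] P Q by (intro ennreal_plus[symmetric]) auto
    qed
    ultimately show ?thesis by (rule trans[OF sym])
  qed
  have "(\<mu> C - outer C S) + (\<mu> C - outer C T)
      = (\<mu> C - outer C (S \<inter> T)) + (\<mu> C - outer C (sublocale_join S T))" if "compactin X C" for C
    using outer_modular[OF that S T] by linarith
  then show ?thesis
    unfolding add[OF S T] add[OF sublocale_set_inter[OF S T] sublocale_set_join[OF S T]]
    by (intro SUP_cong[OF refl] arg_cong[where f = ennreal]) simp
qed

lemma sublocale_measure_directed:
  assumes D: "directed_in (Sl_op X) \<D>"
  shows "sublocale_measure ({U. openin X U} \<inter> \<Inter>\<D>) = (SUP S\<in>\<D>. sublocale_measure S)"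
proof (rule antisym)
  have DS: "sublocale_set X S" if "S \<in> \<D>" for S
    using D that by (auto simp: directed_in_def)
  have ne: "\<D> \<noteq> {}"
    using D by (simp add: directed_in_def)
  have dir: "\<exists>R\<in>\<D>. R \<subseteq> S \<and> R \<subseteq> T" if "S \<in> \<D>" "T \<in> \<D>" for S T
    using D that by (auto simp: directed_in_def)
  let ?I = "{U. openin X U} \<inter> \<Inter>\<D>"
  have I: "sublocale_set X ?I"
    using DS by (rule sublocale_set_Inter)
  show "(SUP S\<in>\<D>. sublocale_measure S) \<le> sublocale_measure ?I"
    by (intro SUP_least sublocale_measure_antimono DS) auto
  let ?H = "\<Union>(nbhds ` \<D>)"
  show "sublocale_measure ?I \<le> (SUP S\<in>\<D>. sublocale_measure S)"
    unfolding sublocale_measure_def[of ?I]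
  proof (rule SUP_least, rule ennreal_le_epsilon)
    fix C and e :: real
    assume "C \<in> {C. compactin X C}" and e: "0 < e"
    then have C: "compactin X C" by simp
    obtain U where U: "U \<in> nbhds ?I" "\<nu> C U < outer C ?I + e/2"
      using outer_approx[OF I, of "e/2" C] e by auto
    obtain W where W: "W \<in> ?H" "\<nu> C W < \<nu> C U + e/2"
    proof (rule nbhds_Inter_approx[OF C, of ?H \<D> U "e/2"])
      show "?H \<noteq> {}"
        using ne topspace_nbhds[OF DS] by blast
      show "openin X W" if "W \<in> ?H" for W
        using that nbhds_openin by blast
      show "\<exists>P\<in>?H. P \<subseteq> V \<inter> W" if V: "V \<in> ?H" and W: "W \<in> ?H" for V W
      proof -
        obtain S T where ST: "S \<in> \<D>" "V \<in> nbhds S" "T \<in> \<D>" "W \<in> nbhds T"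
          using V W by blast
        obtain R where R: "R \<in> \<D>" "R \<subseteq> S" "R \<subseteq> T"
          using dir[OF ST(1,3)] by blast
        have "V \<inter> W \<in> nbhds R"
          using ST R nbhds_antimono[OF R(2)] nbhds_antimono[OF R(3)] by (intro nbhds_Int DS) auto
        then show ?thesis
          using R(1) by blast
      qed
    qed (use U DS e in auto)
    then obtain S where S: "S \<in> \<D>" "W \<in> nbhds S"
      by blast
    have "ennreal (\<mu> C - outer C ?I) \<le> ennreal ((\<mu> C - outer C S) + e)"
      using outer_le[OF C S(2)] W(2) U(2) by (intro ennreal_leI) linarith
    also have "\<dots> = ennreal (\<mu> C - outer C S) + ennreal e"
      using outer_le_mu[OF C DS[OF S(1)]] e by (intro ennreal_plus) auto
    also have "\<dots> \<le> (SUP S\<in>\<D>. sublocale_measure S) + ennreal e"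
      using sublocale_measure_upper[OF C, of S] S(1)
      by (intro add_right_mono) (blast intro: SUP_upper2)
    finally show "ennreal (\<mu> C - outer C ?I) \<le> (SUP S\<in>\<D>. sublocale_measure S) + ennreal e" .
  qed
qed

lemma locale_measure_sublocale_measure: "locale_measure (Sl_op X) sublocale_measure"
  unfolding locale_measure_def
proof (intro conjI ballI allI impI)
  show "frame (Sl_op X)"
    by (rule frame_Sl_op)
  have "ennreal (\<mu> C - outer C {U. openin X U}) = 0" if "compactin X C" for C
    using outer_opens[OF that] by simp
  then show "sublocale_measure \<bottom>\<^bsub>Sl_op X\<^esub> = 0"
    unfolding sublocale_measure_def bottom_Sl_op
    by (simp add: SUP_eq_const flip: bot_ennreal)
  fix S T assume "S \<in> carrier (Sl_op X)" "T \<in> carrier (Sl_op X)"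
  then have ST: "sublocale_set X S" "sublocale_set X T" by auto
  show "sublocale_measure S \<le> sublocale_measure T" if "S \<sqsubseteq>\<^bsub>Sl_op X\<^esub> T"
    using that ST by (simp add: sublocale_measure_antimono)
  show "sublocale_measure S + sublocale_measure T
      = sublocale_measure (S \<squnion>\<^bsub>Sl_op X\<^esub> T) + sublocale_measure (S \<sqinter>\<^bsub>Sl_op X\<^esub> T)"
    using ST by (simp add: join_Sl_op meet_Sl_op sublocale_measure_modular)
next
  fix \<D> assume D: "directed_in (Sl_op X) \<D>"
  then have "\<D> \<subseteq> {S. sublocale_set X S}"
    by (simp add: directed_in_def)
  then show "sublocale_measure (\<Squnion>\<^bsub>Sl_op X\<^esub>\<D>) = (SUP S\<in>\<D>. sublocale_measure S)"
    using sublocale_measure_directed[OF D] by (simp add: sup_Sl_op)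
qed

lemma sublocale_measure_closed_sublocale:
  assumes U: "openin X U"
  shows "sublocale_measure (closed_sublocale (opens X) U) = radon_open_measure X \<mu> U"
proof -
  have "sublocale_measure (closed_sublocale (opens X) U)
      = (SUP C\<in>{C. compactin X C}. ennreal (\<nu> C U))"
    unfolding sublocale_measure_def by (intro SUP_cong) (simp_all add: outer_closed_sublocale U)
  also have "\<dots> = radon_open_measure X \<mu> U"
    unfolding radon_open_measure_def
  proof (rule antisym; rule SUP_least)
    fix C assume "C \<in> {C. compactin X C}"
    then have C: "compactin X C" by simp
    show "ennreal (\<nu> C U) \<le> (SUP K\<in>{K. compactin X K \<and> K \<subseteq> U}. ennreal (\<mu> K))"
    proof (rule ennreal_le_epsilon)
      fix e :: real assume e: "0 < e"
      obtain K where K: "compactin X K" "K \<subseteq> C" "K \<subseteq> U" "\<nu> C U - e < \<mu> K"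
        using nu_approx[OF C e] .
      have "ennreal (\<nu> C U) \<le> ennreal (\<mu> K + e)"
        using K(4) by (intro ennreal_leI) linarith
      also have "\<dots> = ennreal (\<mu> K) + ennreal e"
        using mu_nonneg[OF K(1)] e by (intro ennreal_plus) auto
      also have "\<dots> \<le> (SUP K\<in>{K. compactin X K \<and> K \<subseteq> U}. ennreal (\<mu> K)) + ennreal e"
        using K by (intro add_right_mono SUP_upper) auto
      finally show "ennreal (\<nu> C U)
          \<le> (SUP K\<in>{K. compactin X K \<and> K \<subseteq> U}. ennreal (\<mu> K)) + ennreal e" .
    qed
  next
    fix K assume "K \<in> {K. compactin X K \<and> K \<subseteq> U}"
    then have "compactin X K" "\<nu> K U = \<mu> K"
      by (auto intro: nu_carrier)
    then show "ennreal (\<mu> K) \<le> (SUP C\<in>{C. compactin X C}. ennreal (\<nu> C U))"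
      by (metis (mono_tags, lifting) SUP_upper mem_Collect_eq)
  qed
  finally show ?thesis .
qed

section \<open>Invariance under measure-preserving homeomorphisms\<close>

lemma nbhds_opens_map:
  assumes fg: "homeomorphic_maps X X f g" and S: "sublocale_set X S" and U: "U \<in> nbhds S"
  shows "opens_map X f U \<in> nbhds (opens_map X f ` S)"
  unfolding nbhds_def
proof (intro CollectI conjI ballI impI)
  note Uo = nbhds_openin[OF U]
  show "openin X (opens_map X f U)"
    using opens_map_openin[OF fg Uo] .
  fix W assume "W \<in> opens_map X f ` S" and UW: "opens_map X f U \<subseteq> W"
  then obtain V where V: "V \<in> S" "W = opens_map X f V"
    by blast
  note Vo = sublocale_set_openin[OF S V(1)]
  have gf: "homeomorphic_maps X X g f"
    using fg by (rule homeomorphic_maps_symD)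
  have "U \<subseteq> V"
    using opens_map_adjoint(1)[OF fg Uo opens_map_openin[OF fg Vo]] UW V(2)
      opens_map_inverse[OF gf Vo] by simp
  then have "V = topspace X"
    using U V(1) by (simp add: nbhds_def)
  then show "W = topspace X"
    using fg continuous_map_image_subset_topspace[of X X f] unfolding V(2) homeomorphic_maps_def
    by (auto simp: opens_map_def)
qed

lemma nu_opens_map_le:
  assumes fg: "homeomorphic_maps X X f g"
    and inv: "\<And>K. compactin X K \<Longrightarrow> \<mu> (opens_map X g K) = \<mu> K"
    and C: "compactin X C"
  shows "\<nu> (opens_map X f C) (opens_map X f U) \<le> \<nu> C U"
proof (rule nu_least[OF opens_map_compactin[OF fg C]])
  have gf: "homeomorphic_maps X X g f"
    using fg by (rule homeomorphic_maps_symD)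
  fix K assume K: "compactin X K" "K \<subseteq> opens_map X f C" "K \<subseteq> opens_map X f U"
  have "f (g x) = x" if "x \<in> topspace X" for x
    using fg that by (simp add: homeomorphic_maps_def)
  then have "opens_map X g K \<subseteq> C" "opens_map X g K \<subseteq> U"
    using K(2,3) by (force simp: opens_map_def)+
  then have "\<mu> (opens_map X g K) \<le> \<nu> C U"
    using opens_map_compactin[OF gf K(1)] by (intro mu_le_nu C)
  then show "\<mu> K \<le> \<nu> C U"
    using inv[OF K(1)] by simp
qed

text \<open>Transporting \<open>C\<close> and the neighbourhoods of \<open>S\<close> along \<open>f\<close> gives an inequality; applied to
  the inverse of \<open>f\<close> as well, it becomes an equality.\<close>

lemma sublocale_measure_opens_map_le:
  assumes fg: "homeomorphic_maps X X f g"
    and inv: "\<And>K. compactin X K \<Longrightarrow> \<mu> (opens_map X f K) = \<mu> K"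
      "\<And>K. compactin X K \<Longrightarrow> \<mu> (opens_map X g K) = \<mu> K"
    and S: "sublocale_set X S"
  shows "sublocale_measure S \<le> sublocale_measure (opens_map X f ` S)"
  unfolding sublocale_measure_def[of S]
proof (rule SUP_least)
  fix C assume "C \<in> {C. compactin X C}"
  then have C: "compactin X C" by simp
  note fC = opens_map_compactin[OF fg C]
  have "outer (opens_map X f C) (opens_map X f ` S) \<le> outer C S"
  proof (rule outer_greatest[OF S])
    fix U assume "U \<in> nbhds S"
    then show "outer (opens_map X f C) (opens_map X f ` S) \<le> \<nu> C U"
      using outer_le[OF fC nbhds_opens_map[OF fg S]] nu_opens_map_le[OF fg inv(2) C, of U]
      by (meson order_trans)
  qed
  then have "ennreal (\<mu> C - outer C S)
      \<le> ennreal (\<mu> (opens_map X f C) - outer (opens_map X f C) (opens_map X f ` S))"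
    using inv(1)[OF C] by (intro ennreal_leI) simp
  also have "\<dots> \<le> sublocale_measure (opens_map X f ` S)"
    using fC by (rule sublocale_measure_upper)
  finally show "ennreal (\<mu> C - outer C S) \<le> sublocale_measure (opens_map X f ` S)" .
qed

lemma sublocale_measure_opens_map:
  assumes fg: "homeomorphic_maps X X f g"
    and inv: "\<And>K. compactin X K \<Longrightarrow> \<mu> (opens_map X f K) = \<mu> K"
    and S: "sublocale_set X S"
  shows "sublocale_measure (opens_map X f ` S) = sublocale_measure S"
proof (rule antisym)
  have gf: "homeomorphic_maps X X g f"
    using fg by (rule homeomorphic_maps_symD)
  have inv': "\<mu> (opens_map X g K) = \<mu> K" if "compactin X K" for K
    using inv[OF opens_map_compactin[OF gf that]]
      opens_map_inverse_subset[OF fg compactin_subset_topspace[OF that]] by simp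
  show "sublocale_measure S \<le> sublocale_measure (opens_map X f ` S)"
    using fg inv inv' S by (rule sublocale_measure_opens_map_le)
  have "sublocale_measure (opens_map X f ` S)
      \<le> sublocale_measure (opens_map X g ` opens_map X f ` S)"
    using gf inv' inv sublocale_set_opens_map[OF fg S] by (rule sublocale_measure_opens_map_le)
  then show "sublocale_measure (opens_map X f ` S) \<le> sublocale_measure S"
    using opens_map_image_inverse[OF gf sublocale_set_openin[OF S]] by simp
qed

end

theorem corollary1p8:
  fixes X :: "'a topology" and \<mu> :: "'a set \<Rightarrow> real"
  assumes "Hausdorff_space X"
    and "radon_valuation X \<mu>"
  shows "\<exists>\<mu>\<^sub>s :: 'a set set \<Rightarrow> ennreal.
    locale_measure (sublocale_locale (opens X)) \<mu>\<^sub>s \<and>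
    (\<forall>f. homeomorphic_map X X f \<longrightarrow>
         (\<forall>K. compactin X K \<longrightarrow> \<mu> {x \<in> topspace X. f x \<in> K} = \<mu> K) \<longrightarrow>
         measure_preserving_map
           (sublocale_locale (opens X)) \<mu>\<^sub>s (sublocale_locale (opens X)) \<mu>\<^sub>s
           (sublocale_preimage (opens X) (opens X) (opens_map X f))) \<and>
    measure_preserving_map
      (sublocale_locale (opens X)) \<mu>\<^sub>s (opens X) (radon_open_measure X \<mu>)
      (closed_sublocale (opens X))"
proof -
  interpret radon_space X \<mu>
    using assms by unfold_locales
  have "measure_preserving_map (Sl_op X) sublocale_measure (Sl_op X) sublocale_measure
      (sublocale_preimage (opens X) (opens X) (opens_map X f))"
    if f: "homeomorphic_map X X f"
      and inv: "\<And>K. compactin X K \<Longrightarrow> \<mu> {x \<in> topspace X. f x \<in> K} = \<mu> K" for f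
  proof -
    obtain g where fg: "homeomorphic_maps X X f g"
      using f by (auto simp: homeomorphic_map_maps)
    have "\<mu> (opens_map X f K) = \<mu> K" if "compactin X K" for K
      using inv[OF that] by (simp add: opens_map_def)
    then show ?thesis
      unfolding measure_preserving_map_def
      using frame_hom_sublocale_preimage[OF fg] sublocale_measure_opens_map[OF fg]
      by (simp add: sublocale_preimage_homeomorphic[OF fg])
  qed
  moreover have "measure_preserving_map (Sl_op X) sublocale_measure (opens X)
      (radon_open_measure X \<mu>) (closed_sublocale (opens X))"
    unfolding measure_preserving_map_def
    by (simp add: frame_hom_closed_sublocale sublocale_measure_closed_sublocale)
  ultimately show ?thesis
    using locale_measure_sublocale_measure by (intro exI[of _ sublocale_measure]) blast
qed

end
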